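(* Let $M$ be a $T_1$ MT-algebra with Wallman extension $\mathsf{w}M=\mathbf{RO}(X_{\mathcal C(M)})$, and write $\sigma=\sigma_{\mathcal C(M)}$. Define $\rho:\mathcal O(\mathsf{w}M)\to\mathcal O(M)$ by $$\rho(U)=\bigvee\{u\in\mathcal O(M)\mid\sigma(u)\subseteq U\}.$$ Let $\nu:\mathsf{w}\,\mathcal O(M)\to\mathcal O(M)$, $\nu(I)=\bigvee I$, be the Wallman compactification of the frame $\mathcal O(M)$. Then there is a frame isomorphism $\alpha:\mathcal O(\mathsf{w}M)\to\mathsf{w}\,\mathcal O(M)$ such that $\nu\circ\alpha=\rho$. In particular, $(\mathcal O(\mathsf{w}M),\rho)$ is (up to this isomorphism) the Wallman compactification of $\mathcal O(M)$.
   Context: MT-algebras. An MT-algebra is a pair $(M,\square)$, where $M$ is a complete Boolean algebra and $\square:M\to M$ satisfies $\square 1=1$, $\square(a\wedge b)=\square a\wedge\square b$, $\square a\le a$, $\square a\le\square\square a$. Put $\Diamond a=\neg\square\neg a$. An element $a$ is open if $a=\square a$ and closed if $a=\Diamond a$; $\mathcal O(M)$ (a frame) and $\mathcal C(M)$ are the sets of open and closed elements. $M$ is $T_1$ if every element is a join of closed elements. Wallman extension of $M$. Let $\mathcal B=\mathcal C(M)$. $X_{\mathcal B}$ is the set of proper filters of $\mathcal B$ ordered by inclusion and given the topology of upsets. $\mathbf{RO}(X_{\mathcal B})$ is the complete Boolean algebra of regular open sets of $X_{\mathcal B}$, i.e. upsets $U$ with $U=\{x\mid \mathord{\uparrow}x\subseteq\mathord{\downarrow}U\}$.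 For $a\in M$, $$\sigma_{\mathcal B}(a)=\{x\in X_{\mathcal B}\mid \text{for all } y\in X_{\mathcal B}\text{ with }x\subseteq y\text{ and all }b\in y,\ a\wedge b\ne0\},$$ which is an element of $\mathbf{RO}(X_{\mathcal B})$. $\mathbf{RO}(X_{\mathcal B})$ is made an MT-algebra by declaring its closed elements to be the arbitrary meets of elements of $\{\sigma_{\mathcal B}(b)\mid b\in\mathcal B\}$ (the open elements are the complements of closed ones, and $\square A$ is the largest open element below $A$). Wallman compactification of a frame. A frame $L$ is subfit if $a\nleq b$ implies there is $c\in L$ with $a\vee c=1$ and $b\vee c\ne1$; if $M$ is a $T_1$ MT-algebra then $\mathcal O(M)$ is subfit. In a frame $L$, $u$ is $v$-small if for every $w\in L$, $u\vee w=1$ implies $v\vee w=1$; an element $u$ is suited if $u=\bigvee\{v\in L\mid v\text{ is }u\text{-small}\}$; $L_s$ is the set of suited elements, ordered as in $L$. Let $\mathscr J(L)$ be the frame of ideals of $L$. For subfit $L$, set $\mathsf{w}L=\mathscr J(L)_s$, which is a compact subfit frame; the join map $\nu:\mathsf{w}L\to L$, $\nu(I)=\bigvee I$, is a dense onto frame homomorphism, and $(\mathsf{w}L,\nu)$ is called the Wallman compactification of $L$. *)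

theory Defs
  imports "HOL-Algebra.Complete_Lattice"
begin

section \<open>Frames\<close>

text \<open>All structures are carrier-based: a sub-poset of \<open>L\<close> is \<open>L\<lparr>carrier := S\<rparr>\<close>, and joins,
  meets and bounds are always computed in the poset named in the subscript. Every locale below
  extends \<open>partial_order\<close>, so the equality of the record is the equality of HOL.\<close>

locale frame_lattice = complete_lattice +
  assumes meet_Sup_distrib:
    "\<lbrakk>a \<in> carrier L; S \<subseteq> carrier L\<rbrakk> \<Longrightarrow> a \<sqinter> (\<Squnion>S) = \<Squnion>((\<lambda>s. a \<sqinter> s) ` S)"

definition frame_hom ::
  "('a, 'c) gorder_scheme \<Rightarrow> ('b, 'd) gorder_scheme \<Rightarrow> ('a \<Rightarrow> 'b) \<Rightarrow> bool" where
  "frame_hom K L f \<longleftrightarrow>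
     frame_lattice K \<and> frame_lattice L \<and> f \<in> carrier K \<rightarrow> carrier L \<and>
     f \<top>\<^bsub>K\<^esub> = \<top>\<^bsub>L\<^esub> \<and> meet_pres K L f \<and> sup_pres K L f"

text \<open>The inverse of a bijective frame homomorphism is again a frame homomorphism.\<close>

definition frame_iso ::
  "('a, 'c) gorder_scheme \<Rightarrow> ('b, 'd) gorder_scheme \<Rightarrow> ('a \<Rightarrow> 'b) \<Rightarrow> bool" where
  "frame_iso K L f \<longleftrightarrow> frame_hom K L f \<and> bij_betw f (carrier K) (carrier L)"


section \<open>MT-algebras\<close>

locale complete_boolean_lattice = complete_lattice +
  assumes meet_join_distrib:
      "\<lbrakk>x \<in> carrier L; y \<in> carrier L; z \<in> carrier L\<rbrakk>
        \<Longrightarrow> x \<sqinter> (y \<squnion> z) = (x \<sqinter> y) \<squnion> (x \<sqinter> z)"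
    and complement_exists:
      "x \<in> carrier L \<Longrightarrow> \<exists>y \<in> carrier L. x \<sqinter> y = \<bottom> \<and> x \<squnion> y = \<top>"

definition lattice_compl :: "('a, 'b) gorder_scheme \<Rightarrow> 'a \<Rightarrow> 'a" where
  "lattice_compl L x =
     (THE y. y \<in> carrier L \<and> x \<sqinter>\<^bsub>L\<^esub> y = \<bottom>\<^bsub>L\<^esub> \<and> x \<squnion>\<^bsub>L\<^esub> y = \<top>\<^bsub>L\<^esub>)"

record 'a mt_struct = "'a gorder" +
  mt_box :: "'a \<Rightarrow> 'a"

locale mt_algebra = complete_boolean_lattice M for M :: "('a, 'b) mt_struct_scheme" (structure) +
  assumes box_closed: "a \<in> carrier M \<Longrightarrow> mt_box M a \<in> carrier M"
    and box_top: "mt_box M \<top> = \<top>"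
    and box_meet: "\<lbrakk>a \<in> carrier M; b \<in> carrier M\<rbrakk>
        \<Longrightarrow> mt_box M (a \<sqinter> b) = mt_box M a \<sqinter> mt_box M b"
    and box_le: "a \<in> carrier M \<Longrightarrow> mt_box M a \<sqsubseteq> a"
    and box_box: "a \<in> carrier M \<Longrightarrow> mt_box M a \<sqsubseteq> mt_box M (mt_box M a)"

definition mt_diamond :: "('a, 'b) mt_struct_scheme \<Rightarrow> 'a \<Rightarrow> 'a" where
  "mt_diamond M a = lattice_compl M (mt_box M (lattice_compl M a))"

definition mt_opens :: "('a, 'b) mt_struct_scheme \<Rightarrow> 'a set" where
  "mt_opens M = {a \<in> carrier M. a = mt_box M a}"

definition mt_closeds :: "('a, 'b) mt_struct_scheme \<Rightarrow> 'a set" where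
  "mt_closeds M = {a \<in> carrier M. a = mt_diamond M a}"

definition open_frame :: "('a, 'b) mt_struct_scheme \<Rightarrow> ('a, 'b) mt_struct_scheme" where
  "open_frame M = M\<lparr>carrier := mt_opens M\<rparr>"

definition mt_T1 :: "('a, 'b) mt_struct_scheme \<Rightarrow> bool" where
  "mt_T1 M \<longleftrightarrow> (\<forall>a \<in> carrier M. \<exists>S. S \<subseteq> mt_closeds M \<and> a = \<Squnion>\<^bsub>M\<^esub>S)"


section \<open>The Wallman extension of an MT-algebra\<close>

definition proper_filters :: "('a, 'b) gorder_scheme \<Rightarrow> 'a set set" where
  "proper_filters L = {F. F \<subseteq> carrier L \<and> F \<noteq> {} \<and> F \<noteq> carrier L \<and>
     (\<forall>x \<in> F. \<forall>y \<in> carrier L. x \<sqsubseteq>\<^bsub>L\<^esub> y \<longrightarrow> y \<in> F) \<and>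
     (\<forall>x \<in> F. \<forall>y \<in> F. x \<sqinter>\<^bsub>L\<^esub> y \<in> F)}"

text \<open>A family \<open>X\<close> of sets is ordered by inclusion and carries the topology of upsets. There the
  closure of an upset \<open>U\<close> is its down-closure, and the interior of a set consists of the points
  whose up-closure is contained in it.\<close>

definition up_closure :: "'a set set \<Rightarrow> 'a set set \<Rightarrow> 'a set set" where
  "up_closure X U = {y \<in> X. \<exists>x \<in> U. x \<subseteq> y}"

definition down_closure :: "'a set set \<Rightarrow> 'a set set \<Rightarrow> 'a set set" where
  "down_closure X U = {y \<in> X. \<exists>x \<in> U. y \<subseteq> x}"

definition upsets :: "'a set set \<Rightarrow> 'a set set set" where
  "upsets X = {U. U \<subseteq> X \<and> up_closure X U \<subseteq> U}"

definition regular_upsets :: "'a set set \<Rightarrow> 'a set set set" where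
  "regular_upsets X =
     {U \<in> upsets X. U = {x \<in> X. up_closure X {x} \<subseteq> down_closure X U}}"

definition RO_algebra :: "'a set set \<Rightarrow> 'a set set gorder" where
  "RO_algebra X = \<lparr>carrier = regular_upsets X, eq = (=), le = (\<subseteq>)\<rparr>"

definition wallman_filters :: "('a, 'b) mt_struct_scheme \<Rightarrow> 'a set set" where
  "wallman_filters M = proper_filters (M\<lparr>carrier := mt_closeds M\<rparr>)"

definition wallman_sigma :: "('a, 'b) mt_struct_scheme \<Rightarrow> 'a \<Rightarrow> 'a set set" where
  "wallman_sigma M a = {x \<in> wallman_filters M.
     \<forall>y \<in> wallman_filters M. x \<subseteq> y \<longrightarrow> (\<forall>b \<in> y. a \<sqinter>\<^bsub>M\<^esub> b \<noteq> \<bottom>\<^bsub>M\<^esub>)}"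

definition wallman_closeds :: "('a, 'b) mt_struct_scheme \<Rightarrow> 'a set set set" where
  "wallman_closeds M =
     {\<Sqinter>\<^bsub>RO_algebra (wallman_filters M)\<^esub>S | S. S \<subseteq> wallman_sigma M ` mt_closeds M}"

definition wallman_opens :: "('a, 'b) mt_struct_scheme \<Rightarrow> 'a set set set" where
  "wallman_opens M = lattice_compl (RO_algebra (wallman_filters M)) ` wallman_closeds M"

definition wallman_box :: "('a, 'b) mt_struct_scheme \<Rightarrow> 'a set set \<Rightarrow> 'a set set" where
  "wallman_box M A =
     (THE V. greatest (RO_algebra (wallman_filters M)) V {V \<in> wallman_opens M. V \<subseteq> A})"

definition wallman_extension :: "('a, 'b) mt_struct_scheme \<Rightarrow> 'a set set mt_struct" where
  "wallman_extension M =
     \<lparr>carrier = regular_upsets (wallman_filters M), eq = (=), le = (\<subseteq>),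
      mt_box = wallman_box M\<rparr>"

definition wallman_rho :: "('a, 'b) mt_struct_scheme \<Rightarrow> 'a set set \<Rightarrow> 'a" where
  "wallman_rho M U = \<Squnion>\<^bsub>open_frame M\<^esub>{u \<in> mt_opens M. wallman_sigma M u \<subseteq> U}"


section \<open>The Wallman compactification of a frame\<close>

definition lattice_ideals :: "('a, 'b) gorder_scheme \<Rightarrow> 'a set set" where
  "lattice_ideals L = {I. I \<subseteq> carrier L \<and> I \<noteq> {} \<and>
     (\<forall>x \<in> I. \<forall>y \<in> carrier L. y \<sqsubseteq>\<^bsub>L\<^esub> x \<longrightarrow> y \<in> I) \<and>
     (\<forall>x \<in> I. \<forall>y \<in> I. x \<squnion>\<^bsub>L\<^esub> y \<in> I)}"

definition ideal_frame :: "('a, 'b) gorder_scheme \<Rightarrow> 'a set gorder" where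
  "ideal_frame L = \<lparr>carrier = lattice_ideals L, eq = (=), le = (\<subseteq>)\<rparr>"

definition small_wrt :: "('a, 'b) gorder_scheme \<Rightarrow> 'a \<Rightarrow> 'a \<Rightarrow> bool" where
  "small_wrt L v u \<longleftrightarrow>
     (\<forall>w \<in> carrier L. u \<squnion>\<^bsub>L\<^esub> w = \<top>\<^bsub>L\<^esub> \<longrightarrow> v \<squnion>\<^bsub>L\<^esub> w = \<top>\<^bsub>L\<^esub>)"
    \<comment> \<open>\<open>u\<close> is \<open>v\<close>-small\<close>

definition suited_elements :: "('a, 'b) gorder_scheme \<Rightarrow> 'a set" where
  "suited_elements L =
     {u \<in> carrier L. u = \<Squnion>\<^bsub>L\<^esub>{v \<in> carrier L. small_wrt L u v}}"

definition wallman_frame :: "('a, 'b) gorder_scheme \<Rightarrow> 'a set gorder" where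
  "wallman_frame L = (ideal_frame L)\<lparr>carrier := suited_elements (ideal_frame L)\<rparr>"

definition wallman_nu :: "('a, 'b) gorder_scheme \<Rightarrow> 'a set \<Rightarrow> 'a" where
  "wallman_nu L I = \<Squnion>\<^bsub>L\<^esub>I"

end

theory Submission
  imports Defs
begin

text \<open>For an ideal \<open>I\<close> of a bounded distributive lattice, an ideal \<open>K\<close> is \<open>I\<close>-small iff
  \<open>K \<subseteq> s(I) = {a. \<forall>w. a \<squnion> w = \<top> \<longrightarrow> (\<exists>i \<in> I. i \<squnion> w = \<top>)}\<close>, so the suited ideals are the
  fixed points of \<open>s\<close>; they are closed under intersections and Heyting implication, hence form
  a frame. For an open element \<open>u\<close>, \<open>\<sigma>(u)\<close> consists of the filters none of whose extensions
  contains \<open>\<not>u\<close>, and \<open>\<sigma>(\<not>u)\<close> is its pseudocomplement; therefore the open elements of the Wallman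
  extension are exactly the regularizations of unions of sets \<open>\<sigma>(u)\<close>. The isomorphism sends \<open>U\<close> to
  the ideal \<open>{u. \<sigma>(u) \<subseteq> U}\<close>, whose join is \<open>\<rho>(U)\<close> by definition. A suited ideal \<open>I\<close> is the image
  of the regularization of \<open>\<Union>i \<in> I. \<sigma>(i)\<close>: if \<open>\<sigma>(u)\<close> is contained in the latter and \<open>u \<squnion> w = \<top>\<close>,
  but \<open>i \<squnion> w \<noteq> \<top>\<close> for all \<open>i \<in> I\<close>, then the filter generated by \<open>\<not>w\<close> and all \<open>\<not>i\<close> is proper
  and lies in \<open>\<sigma>(u)\<close>, yet none of its extensions lies in any \<open>\<sigma>(i)\<close>.\<close>

section \<open>Order isomorphisms onto frames\<close>

context partial_order
begin

text \<open>\<open>\<Squnion>\<close> chooses among least upper bounds, and antisymmetry leaves only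
  one. So a bound can be computed before the poset is known to be a lattice; the next lemmas serve
  the same purpose.\<close>

lemma sup_eqI: "is_lub L x A \<Longrightarrow> \<Squnion>A = x"
  unfolding sup_def by (metis someI_ex least_unique)

lemma inf_eqI: "is_glb L x A \<Longrightarrow> \<Sqinter>A = x"
  unfolding inf_def by (metis someI_ex greatest_unique)

lemma join_eqI:
  assumes "x \<in> carrier L" "y \<in> carrier L" "z \<in> carrier L" "x \<sqsubseteq> z" "y \<sqsubseteq> z"
    and "\<And>w. \<lbrakk>w \<in> carrier L; x \<sqsubseteq> w; y \<sqsubseteq> w\<rbrakk> \<Longrightarrow> z \<sqsubseteq> w"
  shows "x \<squnion> y = z"
  unfolding join_def
  by (rule sup_eqI, rule least_UpperI) (use assms in \<open>auto simp: Upper_def\<close>)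

lemma meet_eqI:
  assumes "x \<in> carrier L" "y \<in> carrier L" "z \<in> carrier L" "z \<sqsubseteq> x" "z \<sqsubseteq> y"
    and "\<And>w. \<lbrakk>w \<in> carrier L; w \<sqsubseteq> x; w \<sqsubseteq> y\<rbrakk> \<Longrightarrow> w \<sqsubseteq> z"
  shows "x \<sqinter> y = z"
  unfolding meet_def
  by (rule inf_eqI, rule greatest_LowerI) (use assms in \<open>auto simp: Lower_def\<close>)

lemma top_eqI: "greatest L x (carrier L) \<Longrightarrow> \<top> = x"
  unfolding top_def by (metis someI_ex greatest_unique)

lemma bottom_eqI: "least L x (carrier L) \<Longrightarrow> \<bottom> = x"
  unfolding bottom_def by (metis someI_ex least_unique)

lemma partial_order_subset:
  assumes "A \<subseteq> carrier L"
  shows "partial_order (L\<lparr>carrier := A\<rparr>)"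
proof -
  interpret S: weak_partial_order "L\<lparr>carrier := A\<rparr>"
    by (rule weak_partial_order_subset[OF weak_partial_order_axioms assms])
  show ?thesis
    by unfold_locales (simp add: eq_is_equal)
qed

end

lemma partial_order_inclusion:
  assumes "eq L = (=)" "le L = (\<subseteq>)"
  shows "partial_order L"
  by unfold_locales (auto simp: assms)

text \<open>The element \<open>i\<close> is the Heyting implication from \<open>a\<close> to
  \<open>t\<close>. Thus meeting with \<open>a\<close> has a right adjoint, which forces it to
  preserve arbitrary joins.\<close>

lemma (in complete_lattice) frame_lattice_implicationI:
  assumes "\<And>a t. \<lbrakk>a \<in> carrier L; t \<in> carrier L\<rbrakk> \<Longrightarrow>
    \<exists>i \<in> carrier L. \<forall>s \<in> carrier L. s \<sqsubseteq> i \<longleftrightarrow> a \<sqinter> s \<sqsubseteq> t"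
  shows "frame_lattice L"
proof
  fix a S assume a: "a \<in> carrier L" and S: "S \<subseteq> carrier L"
  let ?t = "\<Squnion>((\<lambda>s. a \<sqinter> s) ` S)"
  have S': "(\<lambda>s. a \<sqinter> s) ` S \<subseteq> carrier L" using a S by auto
  then have t: "?t \<in> carrier L" by simp
  obtain i where i: "i \<in> carrier L" "\<And>s. s \<in> carrier L \<Longrightarrow> s \<sqsubseteq> i \<longleftrightarrow> a \<sqinter> s \<sqsubseteq> ?t"
    using assms[OF a t] by blast
  have "s \<sqsubseteq> i" if "s \<in> S" for s
    using i(2)[of s] S that sup_upper[OF S'] by blast
  then have "\<Squnion>S \<sqsubseteq> i" using sup_least[OF S i(1)] by blast
  then have 1: "a \<sqinter> \<Squnion>S \<sqsubseteq> ?t" using i(2) S by simp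
  have "a \<sqinter> s \<sqsubseteq> a \<sqinter> \<Squnion>S" if "s \<in> S" for s
  proof -
    have s: "s \<in> carrier L" using that S by auto
    have "a \<sqinter> s \<sqsubseteq> \<Squnion>S"
      by (rule le_trans[OF meet_right[OF a s] sup_upper[OF S that]]) (use a s S in auto)
    then show ?thesis using a s S by (simp add: meet_le meet_left)
  qed
  then have "?t \<sqsubseteq> a \<sqinter> \<Squnion>S"
    using a S by (intro sup_least[OF S']) auto
  with 1 show "a \<sqinter> \<Squnion>S = ?t" using a S t by (intro le_antisym) auto
qed

text \<open>\<open>K\<close> is only assumed to be a partial order: bounds and infinite
  distributivity are pulled back from \<open>L\<close> along \<open>f\<close>, so that
  \<open>K\<close> need not be shown to be a frame beforehand.\<close>

lemma frame_isoI:
  assumes K: "partial_order K" and L: "frame_lattice L"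
    and bij: "bij_betw f (carrier K) (carrier L)"
    and le: "\<And>x y. \<lbrakk>x \<in> carrier K; y \<in> carrier K\<rbrakk> \<Longrightarrow> x \<sqsubseteq>\<^bsub>K\<^esub> y \<longleftrightarrow> f x \<sqsubseteq>\<^bsub>L\<^esub> f y"
  shows "frame_iso K L f"
proof -
  interpret K: partial_order K by fact
  interpret L: frame_lattice L by fact
  have img: "f ` carrier K = carrier L" using bij by (simp add: bij_betw_def)
  then have f: "f x \<in> carrier L" if "x \<in> carrier K" for x using that by auto
  have lub: "is_lub K x A" if "A \<subseteq> carrier K" "x \<in> carrier K" "is_lub L (f x) (f ` A)" for x A
  proof (rule least_UpperI)
    show "y \<sqsubseteq>\<^bsub>K\<^esub> x" if "y \<in> A" for y
      using that \<open>is_lub L (f x) (f ` A)\<close> \<open>A \<subseteq> _\<close> \<open>x \<in> _\<close> f le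
      by (meson image_eqI image_subset_iff least_Upper_above subsetD)
    show "x \<sqsubseteq>\<^bsub>K\<^esub> y" if y: "y \<in> Upper K A" for y
    proof -
      have yK: "y \<in> carrier K" using y by (simp add: Upper_def)
      have "f y \<in> Upper L (f ` A)"
        using y yK that(1) f le \<open>A \<subseteq> _\<close> unfolding Upper_def by auto
      then show ?thesis
        using least_le[OF \<open>is_lub L (f x) (f ` A)\<close>] le \<open>x \<in> _\<close> yK by auto
    qed
  qed fact+
  have glb: "is_glb K x A" if "A \<subseteq> carrier K" "x \<in> carrier K" "is_glb L (f x) (f ` A)" for x A
  proof (rule greatest_LowerI)
    show "x \<sqsubseteq>\<^bsub>K\<^esub> y" if "y \<in> A" for y
      using that \<open>is_glb L (f x) (f ` A)\<close> \<open>A \<subseteq> _\<close> \<open>x \<in> _\<close> f le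
      by (meson image_eqI image_subset_iff greatest_Lower_below subsetD)
    show "y \<sqsubseteq>\<^bsub>K\<^esub> x" if y: "y \<in> Lower K A" for y
    proof -
      have yK: "y \<in> carrier K" using y by (simp add: Lower_def)
      have "f y \<in> Lower L (f ` A)"
        using y yK that(1) f le \<open>A \<subseteq> _\<close> unfolding Lower_def by auto
      then show ?thesis
        using greatest_le[OF \<open>is_glb L (f x) (f ` A)\<close>] le \<open>x \<in> _\<close> yK by auto
    qed
  qed fact+
  \<comment> \<open>Surjectivity supplies a preimage of the join in \<open>L\<close>; as
    \<open>f\<close> is an order embedding, this preimage is a least upper bound in
    \<open>K\<close>.\<close>
  have ex_lub: "\<exists>x \<in> carrier K. f x = \<Squnion>\<^bsub>L\<^esub>(f ` A) \<and> is_lub K x A" if A: "A \<subseteq> carrier K" for A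
  proof -
    have fA: "f ` A \<subseteq> carrier L" using A f by auto
    then obtain x where "x \<in> carrier K" "f x = \<Squnion>\<^bsub>L\<^esub>(f ` A)"
      using img L.sup_closed by (metis imageE)
    then show ?thesis using lub[OF A] L.sup_lub[OF fA] by auto
  qed
  have ex_glb: "\<exists>x \<in> carrier K. f x = \<Sqinter>\<^bsub>L\<^esub>(f ` A) \<and> is_glb K x A" if A: "A \<subseteq> carrier K" for A
  proof -
    have fA: "f ` A \<subseteq> carrier L" using A f by auto
    then obtain x where "x \<in> carrier K" "f x = \<Sqinter>\<^bsub>L\<^esub>(f ` A)"
      using img L.inf_closed by (metis imageE)
    then show ?thesis using glb[OF A] L.inf_glb[OF fA] by auto
  qed
  interpret K: complete_lattice K
    by (rule K.complete_latticeI) (use ex_lub ex_glb in blast)+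
  have sup: "f (\<Squnion>\<^bsub>K\<^esub>A) = \<Squnion>\<^bsub>L\<^esub>(f ` A)" if "A \<subseteq> carrier K" for A
    using ex_lub[OF that] K.sup_eqI by metis
  have inf: "f (\<Sqinter>\<^bsub>K\<^esub>A) = \<Sqinter>\<^bsub>L\<^esub>(f ` A)" if "A \<subseteq> carrier K" for A
    using ex_glb[OF that] K.inf_eqI by metis
  have meet: "f (x \<sqinter>\<^bsub>K\<^esub> y) = f x \<sqinter>\<^bsub>L\<^esub> f y" if "x \<in> carrier K" "y \<in> carrier K" for x y
    using inf[of "{x, y}"] that by (simp add: meet_def)
  have inj: "x = y" if "f x = f y" "x \<in> carrier K" "y \<in> carrier K" for x y
    using bij that by (meson bij_betw_def inj_onD)
  \<comment> \<open>By injectivity, the distributive law may be verified after applying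
    \<open>f\<close>, where it is that of \<open>L\<close>.\<close>
  have "frame_lattice K"
  proof
    fix a S assume a: "a \<in> carrier K" and S: "S \<subseteq> carrier K"
    have S': "(\<lambda>s. a \<sqinter>\<^bsub>K\<^esub> s) ` S \<subseteq> carrier K" using a S by auto
    have "f (a \<sqinter>\<^bsub>K\<^esub> \<Squnion>\<^bsub>K\<^esub>S) = f a \<sqinter>\<^bsub>L\<^esub> \<Squnion>\<^bsub>L\<^esub>(f ` S)"
      using a S by (simp add: meet sup)
    also have "\<dots> = \<Squnion>\<^bsub>L\<^esub>((\<lambda>s. f a \<sqinter>\<^bsub>L\<^esub> s) ` f ` S)"
      using a S f by (intro L.meet_Sup_distrib) auto
    also have "(\<lambda>s. f a \<sqinter>\<^bsub>L\<^esub> s) ` f ` S = f ` (\<lambda>s. a \<sqinter>\<^bsub>K\<^esub> s) ` S"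
      unfolding image_image using a S meet by (intro image_cong) auto
    also have "\<Squnion>\<^bsub>L\<^esub>(f ` (\<lambda>s. a \<sqinter>\<^bsub>K\<^esub> s) ` S) = f (\<Squnion>\<^bsub>K\<^esub>((\<lambda>s. a \<sqinter>\<^bsub>K\<^esub> s) ` S))"
      using sup[OF S'] by simp
    finally show "a \<sqinter>\<^bsub>K\<^esub> \<Squnion>\<^bsub>K\<^esub>S = \<Squnion>\<^bsub>K\<^esub>((\<lambda>s. a \<sqinter>\<^bsub>K\<^esub> s) ` S)"
      using a S S' by (intro inj) auto
  qed
  \<comment> \<open>The top is the meet of the empty family, which \<open>inf\<close> already
    covers.\<close>
  moreover have "f \<top>\<^bsub>K\<^esub> = \<top>\<^bsub>L\<^esub>"
    using inf[of "{}"] K.weak_inf_empty L.weak_inf_empty by (simp add: K.eq_is_equal L.eq_is_equal)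
  ultimately show ?thesis
    unfolding frame_iso_def frame_hom_def meet_pres_def sup_pres_def
    using L f bij meet sup K.lattice_axioms L.lattice_axioms
      K.complete_lattice_axioms L.complete_lattice_axioms by auto
qed

section \<open>Suited ideals of a distributive lattice\<close>

locale bounded_distributive_lattice = bounded_lattice +
  assumes meet_join_distrib:
    "\<lbrakk>x \<in> carrier L; y \<in> carrier L; z \<in> carrier L\<rbrakk> \<Longrightarrow> x \<sqinter> (y \<squnion> z) = (x \<sqinter> y) \<squnion> (x \<sqinter> z)"
begin

text \<open>For an ideal \<open>I\<close> this is the largest \<open>I\<close>-small ideal. Only
  covers by two elements occur, so smallness of ideals can be handled elementwise.\<close>

definition suited_closure :: "'a set \<Rightarrow> 'a set" where
  "suited_closure I = {a \<in> carrier L. \<forall>w \<in> carrier L. a \<squnion> w = \<top> \<longrightarrow> (\<exists>i \<in> I. i \<squnion> w = \<top>)}"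

text \<open>Distributing \<open>a\<close> over the cover \<open>b \<squnion> w = \<top>\<close>
  splits it as \<open>(a \<sqinter> b) \<squnion> (a \<sqinter> w)\<close>, and both parts lie below
  \<open>(a \<sqinter> b) \<squnion> w\<close>.\<close>

lemma meet_join_top:
  assumes c: "a \<in> carrier L" "b \<in> carrier L" "w \<in> carrier L"
    and "a \<squnion> w = \<top>" "b \<squnion> w = \<top>"
  shows "(a \<sqinter> b) \<squnion> w = \<top>"
proof -
  have "a = (a \<sqinter> b) \<squnion> (a \<sqinter> w)"
    using meet_join_distrib[of a b w] assms le_iff_join[of a \<top>] by simp
  moreover have "a \<sqinter> w \<sqsubseteq> (a \<sqinter> b) \<squnion> w"
    by (rule le_trans[OF meet_right join_right]) (use c in auto)
  ultimately have "a \<sqsubseteq> (a \<sqinter> b) \<squnion> w"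
    using join_le[of "a \<sqinter> b" "(a \<sqinter> b) \<squnion> w" "a \<sqinter> w"] c by (simp add: join_left)
  then have "a \<squnion> w \<sqsubseteq> (a \<sqinter> b) \<squnion> w"
    using c by (simp add: join_le join_right)
  then show ?thesis using assms by (metis join_closed le_antisym meet_closed top_closed top_higher)
qed

lemma join_top_mono:
  assumes "a \<in> carrier L" "b \<in> carrier L" "w \<in> carrier L" "a \<sqsubseteq> b" "a \<squnion> w = \<top>"
  shows "b \<squnion> w = \<top>"
proof -
  have "a \<sqsubseteq> b \<squnion> w" by (rule le_trans[OF assms(4) join_left]) (use assms in auto)
  then have "a \<squnion> w \<sqsubseteq> b \<squnion> w" using assms(1-3) by (simp add: join_le join_right)
  then show ?thesis using assms by (metis join_closed le_antisym top_closed top_higher)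
qed

section \<open>Ideals of the lattice and their joins\<close>

lemma lattice_idealsD:
  assumes "I \<in> lattice_ideals L"
  shows "I \<subseteq> carrier L" "I \<noteq> {}"
    and "\<And>x y. \<lbrakk>x \<in> I; y \<in> carrier L; y \<sqsubseteq> x\<rbrakk> \<Longrightarrow> y \<in> I"
    and "\<And>x y. \<lbrakk>x \<in> I; y \<in> I\<rbrakk> \<Longrightarrow> x \<squnion> y \<in> I"
  using assms unfolding lattice_ideals_def by blast+

lemma lattice_idealsI:
  assumes "I \<subseteq> carrier L" "\<bottom> \<in> I"
    and "\<And>x y. \<lbrakk>x \<in> I; y \<in> carrier L; y \<sqsubseteq> x\<rbrakk> \<Longrightarrow> y \<in> I"
    and "\<And>x y. \<lbrakk>x \<in> I; y \<in> I\<rbrakk> \<Longrightarrow> x \<squnion> y \<in> I"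
  shows "I \<in> lattice_ideals L"
  using assms unfolding lattice_ideals_def by blast

lemma bottom_in_ideal: "I \<in> lattice_ideals L \<Longrightarrow> \<bottom> \<in> I"
  by (metis bottom_closed bottom_lower ex_in_conv lattice_idealsD(1,2,3) subsetD)

lemma carrier_ideal: "carrier L \<in> lattice_ideals L"
  by (rule lattice_idealsI) auto

lemma principal_ideal:
  assumes "w \<in> carrier L"
  shows "{x \<in> carrier L. x \<sqsubseteq> w} \<in> lattice_ideals L"
  by (rule lattice_idealsI) (use assms in \<open>auto intro: join_le le_trans\<close>)

lemma carrier_ideal_frame: "carrier (ideal_frame L) = lattice_ideals L"
  by (simp add: ideal_frame_def)

lemma partial_order_ideal_frame: "partial_order (ideal_frame L)"
  by (rule partial_order_inclusion) (simp_all add: ideal_frame_def)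

lemma ideal_join:
  assumes I: "I \<in> lattice_ideals L" and J: "J \<in> lattice_ideals L"
  shows "I \<squnion>\<^bsub>ideal_frame L\<^esub> J = {a \<in> carrier L. \<exists>i \<in> I. \<exists>j \<in> J. a \<sqsubseteq> i \<squnion> j}" (is "_ = ?K")
proof -
  interpret F: partial_order "ideal_frame L" by (rule partial_order_ideal_frame)
  note ID = lattice_idealsD[OF I] and JD = lattice_idealsD[OF J]
  have K: "?K \<in> lattice_ideals L"
  proof (rule lattice_idealsI)
    show "\<bottom> \<in> ?K"
      using bottom_in_ideal[OF I] bottom_in_ideal[OF J] bottom_lower[OF join_closed] bottom_closed
      by blast
    show "y \<in> ?K" if "x \<in> ?K" "y \<in> carrier L" "y \<sqsubseteq> x" for x y
    proof -
      obtain i j where ij: "i \<in> I" "j \<in> J" "x \<sqsubseteq> i \<squnion> j" "x \<in> carrier L" using \<open>x \<in> ?K\<close> by auto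
      have c: "i \<in> carrier L" "j \<in> carrier L" using ij ID(1) JD(1) by auto
      have "y \<sqsubseteq> i \<squnion> j" by (rule le_trans[OF that(3) ij(3)]) (simp_all add: that ij c)
      then show ?thesis using that ij by auto
    qed
    show "x \<squnion> y \<in> ?K" if xy: "x \<in> ?K" "y \<in> ?K" for x y
    proof -
      obtain i j where ij: "i \<in> I" "j \<in> J" "x \<sqsubseteq> i \<squnion> j" "x \<in> carrier L" using xy(1) by auto
      obtain i' j' where ij': "i' \<in> I" "j' \<in> J" "y \<sqsubseteq> i' \<squnion> j'" "y \<in> carrier L" using xy(2) by auto
      have c: "i \<in> carrier L" "j \<in> carrier L" "i' \<in> carrier L" "j' \<in> carrier L"
        using ij ij' ID(1) JD(1) by auto
      \<comment> \<open>Regrouping keeps both halves inside the ideals: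
        \<open>i \<squnion> i'\<close> lies in \<open>I\<close> and \<open>j \<squnion> j'\<close>
        in \<open>J\<close>.\<close>
      let ?z = "(i \<squnion> i') \<squnion> (j \<squnion> j')"
      have "i \<sqsubseteq> ?z" "i' \<sqsubseteq> ?z" "j \<sqsubseteq> ?z" "j' \<sqsubseteq> ?z"
        using c by (meson join_closed join_left join_right le_trans)+
      then have "i \<squnion> j \<sqsubseteq> ?z" "i' \<squnion> j' \<sqsubseteq> ?z"
        using c by (simp_all add: join_le)
      then have "x \<sqsubseteq> ?z" "y \<sqsubseteq> ?z"
        using c ij ij' by (meson join_closed le_trans)+
      then have "x \<squnion> y \<sqsubseteq> ?z" using c ij ij' by (simp add: join_le)
      then show ?thesis using ID(4)[OF ij(1) ij'(1)] JD(4)[OF ij(2) ij'(2)] ij ij' by auto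
    qed
  qed auto
  show ?thesis
  proof (rule F.join_eqI; simp add: ideal_frame_def I J K)
    have "i \<sqsubseteq> i \<squnion> j" "j \<sqsubseteq> i \<squnion> j" if "i \<in> I" "j \<in> J" for i j
      using that ID(1) JD(1) by (auto intro!: join_left join_right)
    then show "I \<subseteq> ?K" "J \<subseteq> ?K"
      using ID(1,2) JD(1,2) by blast+
    fix W assume W: "W \<in> lattice_ideals L" "I \<subseteq> W" "J \<subseteq> W"
    show "?K \<subseteq> W"
    proof
      fix a assume "a \<in> ?K"
      then obtain i j where ij: "i \<in> I" "j \<in> J" "a \<sqsubseteq> i \<squnion> j" "a \<in> carrier L" by auto
      then have "i \<squnion> j \<in> W" using W lattice_idealsD(4)[OF W(1)] by auto
      then show "a \<in> W" using lattice_idealsD(3)[OF W(1)] ij by auto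
    qed
  qed
qed

lemma ideal_top: "\<top>\<^bsub>ideal_frame L\<^esub> = carrier L"
  by (rule partial_order.top_eqI[OF partial_order_ideal_frame])
    (auto simp: ideal_frame_def greatest_def carrier_ideal lattice_ideals_def)

text \<open>A join of ideals is everything exactly when it contains \<open>\<top>\<close>, and
  membership of \<open>\<top>\<close> is witnessed by one pair of elements. Smallness of ideals
  thereby becomes a statement about elements.\<close>

lemma ideal_join_top:
  assumes I: "I \<in> lattice_ideals L" and J: "J \<in> lattice_ideals L"
  shows "I \<squnion>\<^bsub>ideal_frame L\<^esub> J = \<top>\<^bsub>ideal_frame L\<^esub> \<longleftrightarrow> (\<exists>i \<in> I. \<exists>j \<in> J. i \<squnion> j = \<top>)"
    (is "?l \<longleftrightarrow> ?r")
proof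
  note c = lattice_idealsD(1)[OF I] lattice_idealsD(1)[OF J]
  show ?r if ?l
  proof -
    have "\<top> \<in> I \<squnion>\<^bsub>ideal_frame L\<^esub> J" using that by (simp add: ideal_top)
    then obtain i j where "i \<in> I" "j \<in> J" "\<top> \<sqsubseteq> i \<squnion> j"
      unfolding ideal_join[OF I J] by auto
    then show ?r using c
      by (meson join_closed le_antisym subsetD top_closed top_higher)
  qed
  show ?l if ?r
    using that c unfolding ideal_join[OF I J] ideal_top by auto (metis top_higher)
qed

text \<open>Closure under joins applies the defining condition twice. In a cover by
  \<open>x\<close>, \<open>y\<close> and \<open>w\<close>, first \<open>x\<close> is replaced by
  some \<open>i\<close> in \<open>I\<close>, then \<open>y\<close> by some \<open>j\<close> in
  \<open>I\<close>, and \<open>j \<squnion> i\<close> serves.\<close>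

lemma suited_closure_ideal:
  assumes I: "I \<in> lattice_ideals L"
  shows "suited_closure I \<in> lattice_ideals L"
proof (rule lattice_idealsI)
  show "suited_closure I \<subseteq> carrier L" by (auto simp: suited_closure_def)
  show "\<bottom> \<in> suited_closure I"
    using bottom_in_ideal[OF I] by (auto simp: suited_closure_def)
  show "y \<in> suited_closure I" if "x \<in> suited_closure I" "y \<in> carrier L" "y \<sqsubseteq> x" for x y
    using that join_top_mono[of y x] by (auto simp: suited_closure_def)
  show "x \<squnion> y \<in> suited_closure I" if x: "x \<in> suited_closure I" and y: "y \<in> suited_closure I" for x y
  proof -
    have "\<exists>i \<in> I. i \<squnion> w = \<top>" if w: "w \<in> carrier L" "(x \<squnion> y) \<squnion> w = \<top>" for w
    proof -
      have c: "x \<in> carrier L" "y \<in> carrier L" using x y by (auto simp: suited_closure_def)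
      have "x \<squnion> (y \<squnion> w) = \<top>" using w c by (simp add: join_assoc)
      then obtain i where i: "i \<in> I" "i \<squnion> (y \<squnion> w) = \<top>"
        using x c w unfolding suited_closure_def by auto
      have ic: "i \<in> carrier L" using i lattice_idealsD(1)[OF I] by auto
      have "y \<squnion> (i \<squnion> w) = \<top>"
        using i(2) ic c w(1) by (metis join_assoc join_comm)
      then obtain j where j: "j \<in> I" "j \<squnion> (i \<squnion> w) = \<top>"
        using y ic w unfolding suited_closure_def by auto
      have "j \<in> carrier L" using j lattice_idealsD(1)[OF I] by auto
      then have "(j \<squnion> i) \<squnion> w = \<top>" using j ic w by (simp add: join_assoc)
      then show ?thesis using lattice_idealsD(4)[OF I j(1) i(1)] by blast
    qed
    then show ?thesis using x y by (auto simp: suited_closure_def)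
  qed
qed

lemma subset_suited_closure: "I \<in> lattice_ideals L \<Longrightarrow> I \<subseteq> suited_closure I"
  using lattice_idealsD(1) by (auto simp: suited_closure_def)

lemma small_wrt_ideal_iff:
  assumes I: "I \<in> lattice_ideals L" and K: "K \<in> lattice_ideals L"
  shows "small_wrt (ideal_frame L) I K \<longleftrightarrow> K \<subseteq> suited_closure I"
proof -
  have "small_wrt (ideal_frame L) I K \<longleftrightarrow>
    (\<forall>W \<in> lattice_ideals L. (\<exists>a \<in> K. \<exists>w \<in> W. a \<squnion> w = \<top>) \<longrightarrow> (\<exists>i \<in> I. \<exists>w \<in> W. i \<squnion> w = \<top>))"
    unfolding small_wrt_def using I K by (simp add: ideal_join_top carrier_ideal_frame)
  also have "\<dots> \<longleftrightarrow> K \<subseteq> suited_closure I"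
  proof
    assume *: "\<forall>W \<in> lattice_ideals L.
      (\<exists>a \<in> K. \<exists>w \<in> W. a \<squnion> w = \<top>) \<longrightarrow> (\<exists>i \<in> I. \<exists>w \<in> W. i \<squnion> w = \<top>)"
    show "K \<subseteq> suited_closure I"
    proof
      fix a assume a: "a \<in> K"
      have "\<exists>i \<in> I. i \<squnion> w = \<top>" if w: "w \<in> carrier L" "a \<squnion> w = \<top>" for w
      proof -
        \<comment> \<open>Smallness is tested against the principal ideal of \<open>w\<close>; the
          resulting \<open>v\<close> lies below \<open>w\<close>, so it can be enlarged to
          \<open>w\<close>.\<close>
        obtain i v where iv: "i \<in> I" "v \<in> carrier L" "v \<sqsubseteq> w" "i \<squnion> v = \<top>"
          using *[rule_format, OF principal_ideal[OF w(1)]] a w by auto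
        have "i \<in> carrier L" using iv lattice_idealsD(1)[OF I] by auto
        then have "i \<squnion> w = \<top>"
          using join_top_mono[of v w i] iv w by (simp add: join_comm)
        then show ?thesis using iv by auto
      qed
      then show "a \<in> suited_closure I"
        using a lattice_idealsD(1)[OF K] by (auto simp: suited_closure_def)
    qed
  next
    assume *: "K \<subseteq> suited_closure I"
    show "\<forall>W \<in> lattice_ideals L.
      (\<exists>a \<in> K. \<exists>w \<in> W. a \<squnion> w = \<top>) \<longrightarrow> (\<exists>i \<in> I. \<exists>w \<in> W. i \<squnion> w = \<top>)"
    proof (intro ballI impI)
      fix W assume W: "W \<in> lattice_ideals L" and "\<exists>a \<in> K. \<exists>w \<in> W. a \<squnion> w = \<top>"
      then obtain a w where aw: "a \<in> K" "w \<in> W" "a \<squnion> w = \<top>" by blast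
      then have "w \<in> carrier L" using lattice_idealsD(1)[OF W] by auto
      then show "\<exists>i \<in> I. \<exists>w \<in> W. i \<squnion> w = \<top>"
        using * aw unfolding suited_closure_def by blast
    qed
  qed
  finally show ?thesis .
qed

text \<open>The \<open>I\<close>-small ideals have a greatest member, the closure of
  \<open>I\<close>. Their join is that member, and suitedness means being a fixed point.\<close>

lemma suited_ideals: "suited_elements (ideal_frame L) = {I \<in> lattice_ideals L. suited_closure I = I}"
proof -
  interpret F: partial_order "ideal_frame L" by (rule partial_order_ideal_frame)
  have "\<Squnion>\<^bsub>ideal_frame L\<^esub>{K \<in> carrier (ideal_frame L). small_wrt (ideal_frame L) I K} = suited_closure I"
    if I: "I \<in> lattice_ideals L" for I
  proof -
    have "{K \<in> carrier (ideal_frame L). small_wrt (ideal_frame L) I K}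
      = {K \<in> lattice_ideals L. K \<subseteq> suited_closure I}"
      using I by (auto simp: ideal_frame_def small_wrt_ideal_iff[unfolded ideal_frame_def])
    moreover have "is_lub (ideal_frame L) (suited_closure I) {K \<in> lattice_ideals L. K \<subseteq> suited_closure I}"
      by (rule least_UpperI) (auto simp: ideal_frame_def Upper_def suited_closure_ideal[OF I])
    ultimately show ?thesis by (simp add: F.sup_eqI)
  qed
  then show ?thesis unfolding suited_elements_def by (auto simp: ideal_frame_def)
qed

text \<open>The closure is monotone, so an intersection of fixed points is again one. Nonemptiness
  matters because \<open>\<Inter>{}\<close> is the whole type.\<close>

lemma suited_ideals_Inter:
  assumes A: "A \<subseteq> suited_elements (ideal_frame L)" "A \<noteq> {}"
  shows "\<Inter>A \<in> suited_elements (ideal_frame L)"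
proof -
  have A': "\<And>I. I \<in> A \<Longrightarrow> I \<in> lattice_ideals L \<and> suited_closure I = I"
    using A unfolding suited_ideals by auto
  have id: "\<Inter>A \<in> lattice_ideals L"
  proof (rule lattice_idealsI)
    show "\<Inter>A \<subseteq> carrier L" using A' A(2) lattice_idealsD(1) by blast
    show "\<bottom> \<in> \<Inter>A" using A' bottom_in_ideal by blast
  qed (use A' lattice_idealsD(3,4) in blast)+
  have "suited_closure (\<Inter>A) \<subseteq> suited_closure I" if "I \<in> A" for I
    using that unfolding suited_closure_def by blast
  then have "suited_closure (\<Inter>A) \<subseteq> \<Inter>A" using A' by blast
  with subset_suited_closure[OF id] id show ?thesis unfolding suited_ideals by auto
qed

text \<open>This is the Heyting implication from \<open>I\<close> to \<open>J\<close> in the lattice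
  of ideals; it inherits suitedness from its conclusion \<open>J\<close>.\<close>

lemma suited_ideals_implication:
  assumes I: "I \<in> lattice_ideals L" and J: "J \<in> suited_elements (ideal_frame L)"
  shows "{a \<in> carrier L. \<forall>i \<in> I. a \<sqinter> i \<in> J} \<in> suited_elements (ideal_frame L)" (is "?H \<in> _")
proof -
  have J': "J \<in> lattice_ideals L" "suited_closure J = J" using J unfolding suited_ideals by auto
  note ID = lattice_idealsD[OF I] and JD = lattice_idealsD[OF J'(1)]
  have H: "?H \<in> lattice_ideals L"
  proof (rule lattice_idealsI)
    show "\<bottom> \<in> ?H"
    proof -
      have "\<bottom> \<sqinter> i \<in> J" if "i \<in> I" for i
      proof -
        have "i \<in> carrier L" using that ID(1) by auto
        then show ?thesis using JD(3)[OF bottom_in_ideal[OF J'(1)]] by (simp add: meet_left)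
      qed
      then show ?thesis by auto
    qed
    show "y \<in> ?H" if "x \<in> ?H" "y \<in> carrier L" "y \<sqsubseteq> x" for x y
    proof -
      have "y \<sqinter> i \<in> J" if "i \<in> I" for i
      proof -
        have c: "i \<in> carrier L" "x \<in> carrier L" using that ID(1) \<open>x \<in> ?H\<close> by auto
        have "y \<sqinter> i \<sqsubseteq> x" 
          by (rule le_trans[OF meet_left \<open>y \<sqsubseteq> x\<close>]) (use c \<open>y \<in> carrier L\<close> in auto)
        then have "y \<sqinter> i \<sqsubseteq> x \<sqinter> i"
          using c \<open>y \<in> carrier L\<close> by (simp add: meet_le meet_right)
        then show ?thesis using JD(3) \<open>x \<in> ?H\<close> that c \<open>y \<in> carrier L\<close> by auto
      qed
      then show ?thesis using that by auto
    qed
    show "x \<squnion> y \<in> ?H" if "x \<in> ?H" "y \<in> ?H" for x y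
    proof -
      have "(x \<squnion> y) \<sqinter> i \<in> J" if "i \<in> I" for i
      proof -
        have "(x \<squnion> y) \<sqinter> i = (x \<sqinter> i) \<squnion> (y \<sqinter> i)"
          using that \<open>x \<in> ?H\<close> \<open>y \<in> ?H\<close> ID(1) meet_join_distrib[of i x y] by (auto simp: meet_comm)
        then show ?thesis using JD(4) \<open>x \<in> ?H\<close> \<open>y \<in> ?H\<close> that by auto
      qed
      then show ?thesis using that by auto
    qed
  qed auto
  have "a \<sqinter> i \<in> suited_closure J" if a: "a \<in> suited_closure ?H" and i: "i \<in> I" for a i
  proof -
    have c: "a \<in> carrier L" "i \<in> carrier L" using a i ID(1) by (auto simp: suited_closure_def)
    have "\<exists>j \<in> J. j \<squnion> w = \<top>" if w: "w \<in> carrier L" "(a \<sqinter> i) \<squnion> w = \<top>" for w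
    proof -
      \<comment> \<open>A cover by \<open>a \<sqinter> i\<close> and \<open>w\<close> yields a cover
        with each factor. Replacing \<open>a\<close> by some \<open>h\<close> and recombining with
        \<open>meet_join_top\<close> produces the required member \<open>h \<sqinter> i\<close> of
        \<open>J\<close>.\<close>
      have "a \<squnion> w = \<top>" "i \<squnion> w = \<top>"
        using join_top_mono[of "a \<sqinter> i"] c w by (auto simp: meet_left meet_right)
      then obtain h where h: "h \<in> ?H" "h \<squnion> w = \<top>"
        using a w unfolding suited_closure_def by blast
      then have "(h \<sqinter> i) \<squnion> w = \<top>"
        using meet_join_top[of h i w] c w \<open>i \<squnion> w = \<top>\<close> by auto
      then show ?thesis using h i by auto
    qed
    then show ?thesis using c by (auto simp: suited_closure_def)
  qed
  then have "suited_closure ?H \<subseteq> ?H"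
    using J'(2) by (auto simp: suited_closure_def[of "?H"])
  with subset_suited_closure[OF H] H show ?thesis unfolding suited_ideals by auto
qed

text \<open>Completeness comes from intersections and a top, and distributivity from implication;
  joins of suited ideals are never computed.\<close>

lemma frame_lattice_wallman_frame: "frame_lattice (wallman_frame L)"
proof -
  let ?W = "wallman_frame L" and ?S = "suited_elements (ideal_frame L)"
  have W: "carrier ?W = ?S" "le ?W = (\<subseteq>)" "eq ?W = (=)"
    by (simp_all add: wallman_frame_def ideal_frame_def)
  interpret W: partial_order ?W by (rule partial_order_inclusion) (simp_all add: W)
  have top: "carrier L \<in> ?S"
    using carrier_ideal subset_suited_closure[OF carrier_ideal]
    by (auto simp: suited_ideals suited_closure_def)
  interpret W: complete_lattice ?W
  proof (rule W.complete_lattice_criterion1)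
    have "greatest ?W (carrier L) (carrier ?W)"
      using top by (auto simp: greatest_def W suited_ideals dest: lattice_idealsD(1))
    then show "\<exists>g. greatest ?W g (carrier ?W)" ..
    fix A assume A: "A \<subseteq> carrier ?W" "A \<noteq> {}"
    then have "is_glb ?W (\<Inter>A) A"
      using suited_ideals_Inter[of A] by (intro greatest_LowerI) (auto simp: W Lower_def)
    then show "\<exists>i. is_glb ?W i A" ..
  qed
  have meet: "I \<sqinter>\<^bsub>?W\<^esub> J = I \<inter> J" if "I \<in> ?S" "J \<in> ?S" for I J
    using that suited_ideals_Inter[of "{I, J}"] by (intro W.meet_eqI) (auto simp: W)
  show ?thesis
  proof (rule W.frame_lattice_implicationI)
    fix I J assume "I \<in> carrier ?W" "J \<in> carrier ?W"
    then have IJ: "I \<in> ?S" "J \<in> ?S" by (simp_all add: W)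
    then have id: "I \<in> lattice_ideals L" "J \<in> lattice_ideals L" by (auto simp: suited_ideals)
    let ?H = "{a \<in> carrier L. \<forall>i \<in> I. a \<sqinter> i \<in> J}"
    have "K \<subseteq> ?H \<longleftrightarrow> I \<inter> K \<subseteq> J" if "K \<in> ?S" for K
    proof
      have K: "K \<in> lattice_ideals L" using that by (auto simp: suited_ideals)
      show "I \<inter> K \<subseteq> J" if *: "K \<subseteq> ?H"
      proof
        fix a assume a: "a \<in> I \<inter> K"
        have "a \<in> carrier L" using a lattice_idealsD(1)[OF K] by auto
        moreover have "a \<sqinter> a \<in> J" using * a by auto
        moreover have "a \<sqsubseteq> a \<sqinter> a" using \<open>a \<in> carrier L\<close> by (simp add: meet_le)
        ultimately show "a \<in> J" using lattice_idealsD(3)[OF id(2)] by blast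
      qed
      show "K \<subseteq> ?H" if *: "I \<inter> K \<subseteq> J"
      proof
        fix a assume a: "a \<in> K"
        have ac: "a \<in> carrier L" using a lattice_idealsD(1)[OF K] by auto
        have "a \<sqinter> i \<in> J" if "i \<in> I" for i
        proof -
          have "i \<in> carrier L" using that lattice_idealsD(1)[OF id(1)] by auto
          then have "a \<sqinter> i \<in> K" "a \<sqinter> i \<in> I"
            using lattice_idealsD(3)[OF K a] lattice_idealsD(3)[OF id(1) that] ac
            by (auto simp: meet_left meet_right)
          then show ?thesis using * by auto
        qed
        then show "a \<in> ?H" using ac by auto
      qed
    qed
    then show "\<exists>H \<in> carrier ?W. \<forall>K \<in> carrier ?W. K \<sqsubseteq>\<^bsub>?W\<^esub> H \<longleftrightarrow> I \<sqinter>\<^bsub>?W\<^esub> K \<sqsubseteq>\<^bsub>?W\<^esub> J"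
      using suited_ideals_implication[OF id(1) IJ(2)] by (auto simp: W meet IJ intro!: bexI[of _ ?H])
  qed
qed

end

section \<open>Regular open sets of upsets\<close>

text \<open>The interior of the complement of \<open>A\<close> in the topology of upsets on
  \<open>X\<close>. Applied twice to a subset of \<open>X\<close>, it gives the interior of the
  closure, that is, the regularization.\<close>

definition pseudo_compl :: "'a set set \<Rightarrow> 'a set set \<Rightarrow> 'a set set" where
  "pseudo_compl X A = {x \<in> X. \<forall>y \<in> X. x \<subseteq> y \<longrightarrow> y \<notin> A}"

lemma upsets_iff: "U \<in> upsets X \<longleftrightarrow> U \<subseteq> X \<and> (\<forall>x \<in> U. \<forall>y \<in> X. x \<subseteq> y \<longrightarrow> y \<in> U)"
  unfolding upsets_def up_closure_def by blast

text \<open>For an upset, one inclusion of the defining equation is automatic. What remains is a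
  density criterion: a point whose every extension can be extended into \<open>U\<close> lies in
  \<open>U\<close>.\<close>

lemma regular_upsets_iff:
  "U \<in> regular_upsets X \<longleftrightarrow>
    U \<in> upsets X \<and> (\<forall>x \<in> X. (\<forall>y \<in> X. x \<subseteq> y \<longrightarrow> (\<exists>z \<in> U. y \<subseteq> z)) \<longrightarrow> x \<in> U)"
proof
  assume "U \<in> regular_upsets X"
  then have "U \<in> upsets X" and eq: "U = {x \<in> X. up_closure X {x} \<subseteq> down_closure X U}"
    unfolding regular_upsets_def by auto
  moreover have "x \<in> U" if "x \<in> X" "\<forall>y \<in> X. x \<subseteq> y \<longrightarrow> (\<exists>z \<in> U. y \<subseteq> z)" for x
    by (subst eq) (use that in \<open>auto simp: up_closure_def down_closure_def\<close>)
  ultimately show "U \<in> upsets X \<and> (\<forall>x \<in> X. (\<forall>y \<in> X. x \<subseteq> y \<longrightarrow> (\<exists>z \<in> U. y \<subseteq> z)) \<longrightarrow> x \<in> U)"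
    by blast
next
  assume *: "U \<in> upsets X \<and> (\<forall>x \<in> X. (\<forall>y \<in> X. x \<subseteq> y \<longrightarrow> (\<exists>z \<in> U. y \<subseteq> z)) \<longrightarrow> x \<in> U)"
  then have U: "U \<subseteq> X" "\<And>x y. \<lbrakk>x \<in> U; y \<in> X; x \<subseteq> y\<rbrakk> \<Longrightarrow> y \<in> U"
    unfolding upsets_iff by blast+
  have "U = {x \<in> X. up_closure X {x} \<subseteq> down_closure X U}"
  proof (intro equalityI subsetI)
    fix x assume "x \<in> U"
    then show "x \<in> {x \<in> X. up_closure X {x} \<subseteq> down_closure X U}"
      using U(1) U(2)[of x] by (auto simp: up_closure_def down_closure_def)
  next
    fix x assume "x \<in> {x \<in> X. up_closure X {x} \<subseteq> down_closure X U}"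
    then have "x \<in> X" "\<And>y. \<lbrakk>y \<in> X; x \<subseteq> y\<rbrakk> \<Longrightarrow> \<exists>z \<in> U. y \<subseteq> z"
      by (auto simp: up_closure_def down_closure_def)
    then show "x \<in> U" using * by simp
  qed
  then show "U \<in> regular_upsets X" using * unfolding regular_upsets_def by blast
qed

lemma regular_upset: "U \<in> regular_upsets X \<Longrightarrow> U \<in> upsets X"
  by (simp add: regular_upsets_iff)

lemma regular_upset_subset: "U \<in> regular_upsets X \<Longrightarrow> U \<subseteq> X"
  by (simp add: regular_upsets_iff upsets_iff)

lemma upsetD: "\<lbrakk>U \<in> upsets X; x \<in> U; y \<in> X; x \<subseteq> y\<rbrakk> \<Longrightarrow> y \<in> U"
  by (simp add: upsets_iff)

lemma regular_upsetI:
  assumes "U \<in> upsets X"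
    and "\<And>x. \<lbrakk>x \<in> X; \<And>y. \<lbrakk>y \<in> X; x \<subseteq> y\<rbrakk> \<Longrightarrow> \<exists>z \<in> U. y \<subseteq> z\<rbrakk> \<Longrightarrow> x \<in> U"
  shows "U \<in> regular_upsets X"
  using assms by (simp add: regular_upsets_iff)

lemma regular_upsetD:
  assumes "U \<in> regular_upsets X" "x \<in> X" "\<And>y. \<lbrakk>y \<in> X; x \<subseteq> y\<rbrakk> \<Longrightarrow> \<exists>z \<in> U. y \<subseteq> z"
  shows "x \<in> U"
  using assms by (simp add: regular_upsets_iff)

lemma pseudo_compl_regular:
  assumes A: "A \<in> upsets X"
  shows "pseudo_compl X A \<in> regular_upsets X"
proof (rule regular_upsetI)
  show "pseudo_compl X A \<in> upsets X"
    unfolding upsets_iff pseudo_compl_def by (auto dest: order_trans)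
  fix x assume x: "x \<in> X" "\<And>y. \<lbrakk>y \<in> X; x \<subseteq> y\<rbrakk> \<Longrightarrow> \<exists>z \<in> pseudo_compl X A. y \<subseteq> z"
  have "y \<notin> A" if y: "y \<in> X" "x \<subseteq> y" for y
  proof
    assume "y \<in> A"
    obtain z where "z \<in> pseudo_compl X A" "y \<subseteq> z" using x(2)[OF y] by auto
    then show False using upsetD[OF A \<open>y \<in> A\<close>, of z] by (auto simp: pseudo_compl_def)
  qed
  then show "x \<in> pseudo_compl X A" using x(1) by (simp add: pseudo_compl_def)
qed

lemma pseudo_compl_antimono: "A \<subseteq> B \<Longrightarrow> pseudo_compl X B \<subseteq> pseudo_compl X A"
  unfolding pseudo_compl_def by blast

lemma subset_double_pseudo_compl:
  "U \<in> upsets X \<Longrightarrow> U \<subseteq> pseudo_compl X (pseudo_compl X U)"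
  unfolding upsets_iff pseudo_compl_def by blast

text \<open>Lying in the double pseudocomplement means that every extension can be extended into
  \<open>U\<close>, which is exactly the density criterion for regularity.\<close>

lemma double_pseudo_compl:
  assumes "U \<in> regular_upsets X"
  shows "pseudo_compl X (pseudo_compl X U) = U"
proof
  show "pseudo_compl X (pseudo_compl X U) \<subseteq> U"
  proof
    fix x assume x: "x \<in> pseudo_compl X (pseudo_compl X U)"
    show "x \<in> U"
    proof (rule regular_upsetD[OF assms])
      show "\<exists>z \<in> U. y \<subseteq> z" if "y \<in> X" "x \<subseteq> y" for y
        using x that unfolding pseudo_compl_def by simp meson
    qed (use x in \<open>simp add: pseudo_compl_def\<close>)
  qed
qed (rule subset_double_pseudo_compl[OF regular_upset[OF assms]])

lemma double_pseudo_complE: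
  assumes "x \<in> pseudo_compl X (pseudo_compl X A)"
  obtains z where "z \<in> X" "x \<subseteq> z" "z \<in> A"
  using assms by (auto simp: pseudo_compl_def)

lemma double_pseudo_compl_subset:
  assumes "A \<subseteq> U" "U \<in> regular_upsets X"
  shows "pseudo_compl X (pseudo_compl X A) \<subseteq> U"
  using pseudo_compl_antimono[OF pseudo_compl_antimono[OF assms(1)]] double_pseudo_compl[OF assms(2)]
  by blast

text \<open>Intersecting with \<open>X\<close> gives the right value for an empty family, where the
  intersection alone would be the whole type; the same holds in
  \<open>regular_upsets_Inter\<close>.\<close>

lemma pseudo_compl_UN: "pseudo_compl X (\<Union>i \<in> I. A i) = X \<inter> (\<Inter>i \<in> I. pseudo_compl X (A i))"
  unfolding pseudo_compl_def by blast

lemma upsets_Un: "U \<in> upsets X \<Longrightarrow> V \<in> upsets X \<Longrightarrow> U \<union> V \<in> upsets X"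
  unfolding upsets_iff by blast

lemma upsets_UN: "(\<And>i. i \<in> I \<Longrightarrow> A i \<in> upsets X) \<Longrightarrow> (\<Union>i \<in> I. A i) \<in> upsets X"
  unfolding upsets_iff by blast

lemma regular_upsets_Inter:
  "S \<subseteq> regular_upsets X \<Longrightarrow> X \<inter> \<Inter>S \<in> regular_upsets X"
proof (rule regular_upsetI)
  assume S: "S \<subseteq> regular_upsets X"
  then have up: "U \<in> upsets X" if "U \<in> S" for U using that by (auto dest: regular_upset)
  show "X \<inter> \<Inter>S \<in> upsets X"
    unfolding upsets_iff using upsetD[OF up] by (simp add: Ball_def) meson
  fix x assume x: "x \<in> X" "\<And>y. \<lbrakk>y \<in> X; x \<subseteq> y\<rbrakk> \<Longrightarrow> \<exists>z \<in> X \<inter> \<Inter>S. y \<subseteq> z"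
  have "x \<in> U" if "U \<in> S" for U
  proof (rule regular_upsetD)
    show "U \<in> regular_upsets X" using S that by auto
    show "\<exists>z \<in> U. y \<subseteq> z" if "y \<in> X" "x \<subseteq> y" for y
      using x(2)[OF that] \<open>U \<in> S\<close> by auto
  qed (rule x(1))
  then show "x \<in> X \<inter> \<Inter>S" using x(1) by simp
qed

section \<open>Boolean operations of the regular open algebra\<close>

lemma carrier_RO: "carrier (RO_algebra X) = regular_upsets X"
  by (simp add: RO_algebra_def)

lemma partial_order_RO: "partial_order (RO_algebra X)"
  by (rule partial_order_inclusion) (simp_all add: RO_algebra_def)

lemma RO_Inf:
  assumes "S \<subseteq> regular_upsets X"
  shows "\<Sqinter>\<^bsub>RO_algebra X\<^esub>S = X \<inter> \<Inter>S"
proof (rule partial_order.inf_eqI[OF partial_order_RO], rule greatest_LowerI)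
  fix U assume "U \<in> Lower (RO_algebra X) S"
  then have "U \<in> regular_upsets X" "\<And>V. V \<in> S \<Longrightarrow> U \<subseteq> V"
    using assms by (auto simp: RO_algebra_def Lower_def)
  then show "U \<sqsubseteq>\<^bsub>RO_algebra X\<^esub> X \<inter> \<Inter>S"
    using regular_upset_subset[of U X] by (simp add: RO_algebra_def Inter_greatest)
qed (use assms regular_upsets_Inter[OF assms] in \<open>simp_all add: RO_algebra_def Inter_lower le_infI2\<close>)

lemma RO_meet:
  assumes "U \<in> regular_upsets X" "V \<in> regular_upsets X"
  shows "U \<sqinter>\<^bsub>RO_algebra X\<^esub> V = U \<inter> V"
  using RO_Inf[of "{U, V}" X] assms regular_upset_subset unfolding meet_def by auto

lemma RO_join:
  assumes U: "U \<in> regular_upsets X" and V: "V \<in> regular_upsets X"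
  shows "U \<squnion>\<^bsub>RO_algebra X\<^esub> V = pseudo_compl X (pseudo_compl X (U \<union> V))"
proof (rule partial_order.join_eqI[OF partial_order_RO])
  have UV: "U \<union> V \<in> upsets X" using U V by (intro upsets_Un regular_upset)
  show "pseudo_compl X (pseudo_compl X (U \<union> V)) \<in> carrier (RO_algebra X)"
    using UV by (simp add: RO_algebra_def pseudo_compl_regular regular_upset)
  show "U \<sqsubseteq>\<^bsub>RO_algebra X\<^esub> pseudo_compl X (pseudo_compl X (U \<union> V))"
    "V \<sqsubseteq>\<^bsub>RO_algebra X\<^esub> pseudo_compl X (pseudo_compl X (U \<union> V))"
    using subset_double_pseudo_compl[OF UV] by (auto simp: RO_algebra_def)
  show "pseudo_compl X (pseudo_compl X (U \<union> V)) \<sqsubseteq>\<^bsub>RO_algebra X\<^esub> W"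
    if "W \<in> carrier (RO_algebra X)" "U \<sqsubseteq>\<^bsub>RO_algebra X\<^esub> W" "V \<sqsubseteq>\<^bsub>RO_algebra X\<^esub> W" for W
    using that double_pseudo_compl_subset[of "U \<union> V" W X] by (simp add: RO_algebra_def)
qed (use U V in \<open>simp_all add: RO_algebra_def\<close>)

lemma RO_bottom: "\<bottom>\<^bsub>RO_algebra X\<^esub> = {}"
  by (rule partial_order.bottom_eqI[OF partial_order_RO])
    (auto simp: least_def RO_algebra_def regular_upsets_iff upsets_iff)

lemma RO_top: "\<top>\<^bsub>RO_algebra X\<^esub> = X"
  by (rule partial_order.top_eqI[OF partial_order_RO])
    (auto simp: greatest_def RO_algebra_def regular_upsets_iff upsets_iff)

text \<open>As \<open>lattice_compl\<close> is a definite description, uniqueness of the complement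
  is proved along with existence.\<close>

lemma RO_compl:
  assumes U: "U \<in> regular_upsets X"
  shows "lattice_compl (RO_algebra X) U = pseudo_compl X U"
proof -
  have N: "pseudo_compl X U \<in> regular_upsets X"
    by (rule pseudo_compl_regular[OF regular_upset[OF U]])
  have "U \<inter> pseudo_compl X U = {}" by (auto simp: pseudo_compl_def)
  \<comment> \<open>The union is dense: a point with no extension in \<open>U\<close> already lies
    in \<open>pseudo_compl X U\<close>.\<close>
  moreover have "pseudo_compl X (pseudo_compl X (U \<union> pseudo_compl X U)) = X"
    unfolding pseudo_compl_def by blast
  moreover have "V = pseudo_compl X U"
    if V: "V \<in> regular_upsets X" "U \<inter> V = {}" "pseudo_compl X (pseudo_compl X (U \<union> V)) = X" for V
  proof
    show "V \<subseteq> pseudo_compl X U"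
      using V(2) upsetD[OF regular_upset[OF V(1)]] regular_upset_subset[OF V(1)]
      by (auto simp: pseudo_compl_def)
    have "x \<in> V" if x: "x \<in> pseudo_compl X U" for x
    proof -
      have xX: "x \<in> X" using x by (simp add: pseudo_compl_def)
      have "\<exists>z \<in> V. y \<subseteq> z" if y: "y \<in> X" "x \<subseteq> y" for y
      proof -
        \<comment> \<open>Joining to the top makes \<open>U \<union> V\<close> dense. Above a point
          of the pseudocomplement of \<open>U\<close> only \<open>V\<close> can supply the
          extension, so \<open>V\<close> is dense there and regularity applies.\<close>
        have "y \<in> pseudo_compl X (pseudo_compl X (U \<union> V))" using V(3) y by simp
        then obtain z where z: "z \<in> X" "y \<subseteq> z" "z \<in> U \<union> V"
          using y by (auto simp: pseudo_compl_def)
        moreover have "z \<notin> U" using x z(1) order_trans[OF y(2) z(2)] by (simp add: pseudo_compl_def)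
        ultimately show ?thesis by auto
      qed
      then show ?thesis by (rule regular_upsetD[OF V(1) xX])
    qed
    then show "pseudo_compl X U \<subseteq> V" by blast
  qed
  ultimately show ?thesis
    unfolding lattice_compl_def RO_bottom RO_top
    by (intro the_equality) (auto simp: RO_meet[OF U] RO_join[OF U] carrier_RO N)
qed

section \<open>Open and closed elements of an MT-algebra\<close>

context complete_boolean_lattice
begin

abbreviation neg :: "'a \<Rightarrow> 'a" where
  "neg \<equiv> lattice_compl L"

text \<open>By distributivity \<open>z\<close> is
  \<open>(z \<sqinter> x) \<squnion> (z \<sqinter> y)\<close>, and the first part vanishes.
  Uniqueness of complements is two applications of this.\<close>

lemma meet_bottom_join:
  assumes c: "x \<in> carrier L" "y \<in> carrier L" "z \<in> carrier L"
    and "z \<sqinter> x = \<bottom>" "z \<sqsubseteq> x \<squnion> y"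
  shows "z \<sqsubseteq> y"
proof -
  have "z = z \<sqinter> (x \<squnion> y)" using assms by (simp add: le_iff_join[symmetric])
  also have "\<dots> = \<bottom> \<squnion> (z \<sqinter> y)" using assms by (simp add: meet_join_distrib)
  also have "\<dots> \<sqsubseteq> y" using c by (intro join_le) (auto intro: meet_right)
  finally show ?thesis .
qed

lemma neg_unique:
  assumes "x \<in> carrier L" "y \<in> carrier L" "x \<sqinter> y = \<bottom>" "x \<squnion> y = \<top>"
  shows "neg x = y"
  unfolding lattice_compl_def
proof (rule the_equality)
  fix z assume z: "z \<in> carrier L \<and> x \<sqinter> z = \<bottom> \<and> x \<squnion> z = \<top>"
  have "z \<sqsubseteq> y" using meet_bottom_join[of x y z] z assms by (simp add: meet_comm)
  moreover have "y \<sqsubseteq> z" using meet_bottom_join[of x z y] z assms by (simp add: meet_comm)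
  ultimately show "z = y" using z assms by (simp add: le_antisym)
qed (use assms in simp)

lemma neg_props:
  assumes "x \<in> carrier L"
  shows neg_closed: "neg x \<in> carrier L"
    and meet_neg: "x \<sqinter> neg x = \<bottom>"
    and join_neg: "x \<squnion> neg x = \<top>"
  using complement_exists[OF assms] neg_unique[OF assms] by auto

lemma neg_neg: "x \<in> carrier L \<Longrightarrow> neg (neg x) = x"
  by (rule neg_unique) (auto simp: neg_props meet_comm[of L "neg x"] join_comm[of L "neg x"])

lemma le_iff_meet_neg:
  assumes "x \<in> carrier L" "y \<in> carrier L"
  shows "x \<sqsubseteq> y \<longleftrightarrow> x \<sqinter> neg y = \<bottom>"
proof
  note c = assms neg_closed[OF assms(2)]
  show "x \<sqinter> neg y = \<bottom>" if "x \<sqsubseteq> y"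
  proof (rule le_antisym)
    have "x \<sqinter> neg y \<sqsubseteq> y" by (rule le_trans[OF meet_left that]) (use c in auto)
    then have "x \<sqinter> neg y \<sqsubseteq> y \<sqinter> neg y" using c by (simp add: meet_le meet_right)
    then show "x \<sqinter> neg y \<sqsubseteq> \<bottom>" using meet_neg[OF assms(2)] by simp
  qed (use c in auto)
  show "x \<sqsubseteq> y" if "x \<sqinter> neg y = \<bottom>"
    using meet_bottom_join[of "neg y" y x] that c join_neg[OF assms(2)]
    by (simp add: join_comm[of L "neg y"])
qed

lemma le_neg_swap:
  "\<lbrakk>x \<in> carrier L; y \<in> carrier L\<rbrakk> \<Longrightarrow> x \<sqsubseteq> neg y \<longleftrightarrow> y \<sqsubseteq> neg x"
  by (simp add: le_iff_meet_neg neg_closed neg_neg meet_comm)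

lemma join_top_iff:
  assumes "x \<in> carrier L" "y \<in> carrier L"
  shows "x \<squnion> y = \<top> \<longleftrightarrow> neg x \<sqsubseteq> y"
proof
  note c = assms neg_closed[OF assms(1)]
  show "neg x \<sqsubseteq> y" if "x \<squnion> y = \<top>"
    using meet_bottom_join[of x y "neg x"] that c meet_neg[OF assms(1)]
    by (simp add: meet_comm[of L "neg x"])
  show "x \<squnion> y = \<top>" if "neg x \<sqsubseteq> y"
  proof (rule le_antisym)
    have "neg x \<sqsubseteq> x \<squnion> y" by (rule le_trans[OF that join_right]) (use c in auto)
    then have "x \<squnion> neg x \<sqsubseteq> x \<squnion> y" using c by (simp add: join_le join_left)
    then show "\<top> \<sqsubseteq> x \<squnion> y" using join_neg[OF assms(1)] by simp
  qed (use c in auto)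
qed

lemma neg_join:
  assumes "x \<in> carrier L" "y \<in> carrier L"
  shows "neg (x \<squnion> y) = neg x \<sqinter> neg y"
proof (rule le_antisym)
  note c = assms neg_closed[OF assms(1)] neg_closed[OF assms(2)]
  \<comment> \<open>Both sides of the De Morgan law have the same lower bounds:
    \<open>z \<sqsubseteq> neg a\<close> turns into \<open>a \<sqsubseteq> neg z\<close>, where the
    universal property of the join applies.\<close>
  have "z \<sqsubseteq> neg (x \<squnion> y) \<longleftrightarrow> z \<sqsubseteq> neg x \<and> z \<sqsubseteq> neg y" if z: "z \<in> carrier L" for z
  proof -
    have "x \<squnion> y \<sqsubseteq> neg z \<longleftrightarrow> x \<sqsubseteq> neg z \<and> y \<sqsubseteq> neg z"
      using c z by (meson join_closed join_le join_left join_right le_trans neg_closed)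
    then show ?thesis using c z by (simp add: le_neg_swap[of z])
  qed
  from this[of "neg (x \<squnion> y)"] this[of "neg x \<sqinter> neg y"]
  show "neg (x \<squnion> y) \<sqsubseteq> neg x \<sqinter> neg y" "neg x \<sqinter> neg y \<sqsubseteq> neg (x \<squnion> y)"
    using c by (simp_all add: meet_le meet_left meet_right neg_closed)
qed (use assms in \<open>simp_all add: neg_closed\<close>)

lemma neg_meet:
  assumes "x \<in> carrier L" "y \<in> carrier L"
  shows "neg (x \<sqinter> y) = neg x \<squnion> neg y"
  using neg_join[of "neg x" "neg y"] neg_neg[of "neg x \<squnion> neg y"] assms
  by (simp add: neg_neg neg_closed)

lemma neg_top: "neg \<top> = \<bottom>"
  using le_iff_join[of \<bottom> \<top>] le_iff_meet[of \<bottom> \<top>]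
  by (intro neg_unique) (auto simp: meet_comm[of L \<top>] join_comm[of L \<top>])

lemma neg_bottom: "neg \<bottom> = \<top>"
  using neg_neg[of \<top>] by (simp add: neg_top)

end

context mt_algebra
begin

lemma opens_carrier: "mt_opens M \<subseteq> carrier M" and closeds_carrier: "mt_closeds M \<subseteq> carrier M"
  by (auto simp: mt_opens_def mt_closeds_def)

lemma open_carrier: "u \<in> mt_opens M \<Longrightarrow> u \<in> carrier M"
  and closed_carrier: "c \<in> mt_closeds M \<Longrightarrow> c \<in> carrier M"
  using opens_carrier closeds_carrier by auto

lemma open_meet: "\<lbrakk>u \<in> mt_opens M; v \<in> mt_opens M\<rbrakk> \<Longrightarrow> u \<sqinter> v \<in> mt_opens M"
  by (simp add: mt_opens_def box_meet)

lemma box_mono: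
  assumes "a \<in> carrier M" "b \<in> carrier M" "a \<sqsubseteq> b"
  shows "mt_box M a \<sqsubseteq> mt_box M b"
proof -
  have "a = a \<sqinter> b" using assms by (simp add: le_iff_join[symmetric])
  then have "mt_box M a = mt_box M a \<sqinter> mt_box M b" using box_meet[of a b] assms by simp
  then show ?thesis using assms by (simp add: le_iff_join box_closed)
qed

lemma openI: "\<lbrakk>a \<in> carrier M; a \<sqsubseteq> mt_box M a\<rbrakk> \<Longrightarrow> a \<in> mt_opens M"
  by (simp add: mt_opens_def box_le box_closed le_antisym)

lemma open_join:
  assumes "u \<in> mt_opens M" "v \<in> mt_opens M"
  shows "u \<squnion> v \<in> mt_opens M"
proof (rule openI)
  note c = open_carrier[OF assms(1)] open_carrier[OF assms(2)]
  have "mt_box M u \<sqsubseteq> mt_box M (u \<squnion> v)" "mt_box M v \<sqsubseteq> mt_box M (u \<squnion> v)"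
    using c by (simp_all add: box_mono join_left join_right)
  then show "u \<squnion> v \<sqsubseteq> mt_box M (u \<squnion> v)"
    using assms c by (intro join_le) (auto simp: mt_opens_def box_closed)
qed (use assms in \<open>simp add: open_carrier\<close>)

lemma open_top: "\<top> \<in> mt_opens M"
  by (simp add: mt_opens_def box_top)

lemma open_bottom: "\<bottom> \<in> mt_opens M"
  by (simp add: openI box_closed)

text \<open>As \<open>mt_diamond\<close> is \<open>mt_box\<close> conjugated by the involution
  \<open>neg\<close>, its fixed points are the complements of those of
  \<open>mt_box\<close>.\<close>

lemma closed_iff: "c \<in> mt_closeds M \<longleftrightarrow> c \<in> carrier M \<and> neg c \<in> mt_opens M"
proof (cases "c \<in> carrier M")
  case True
  then have "c = neg (mt_box M (neg c)) \<longleftrightarrow> neg c = mt_box M (neg c)"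
    by (metis box_closed neg_closed neg_neg)
  then show ?thesis using True by (simp add: mt_closeds_def mt_opens_def mt_diamond_def neg_closed)
qed (simp add: mt_closeds_def)

lemma neg_open: "u \<in> mt_opens M \<Longrightarrow> neg u \<in> mt_closeds M"
  by (simp add: closed_iff open_carrier neg_closed neg_neg)

lemma neg_closed_open: "c \<in> mt_closeds M \<Longrightarrow> neg c \<in> mt_opens M"
  by (simp add: closed_iff)

lemma closed_meet: "\<lbrakk>c \<in> mt_closeds M; d \<in> mt_closeds M\<rbrakk> \<Longrightarrow> c \<sqinter> d \<in> mt_closeds M"
  by (simp add: closed_iff neg_meet open_join)

lemma closed_top: "\<top> \<in> mt_closeds M"
  using neg_open[OF open_bottom] by (simp add: neg_bottom)

lemma closed_bottom: "\<bottom> \<in> mt_closeds M"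
  using neg_open[OF open_top] by (simp add: neg_top)

text \<open>Restricting the carrier only removes competing upper bounds, so a join of
  \<open>M\<close> that survives the restriction stays least. With the dual \<open>sub_meet\<close>,
  this lets suborders use the operations of \<open>M\<close>.\<close>

lemma sub_join:
  assumes "S \<subseteq> carrier M" "x \<in> S" "y \<in> S" "x \<squnion> y \<in> S"
  shows "x \<squnion>\<^bsub>M\<lparr>carrier := S\<rparr>\<^esub> y = x \<squnion> y"
proof (rule partial_order.join_eqI[OF partial_order_subset[OF assms(1)]])
  have c: "x \<in> carrier M" "y \<in> carrier M" using assms by auto
  show "x \<sqsubseteq>\<^bsub>M\<lparr>carrier := S\<rparr>\<^esub> x \<squnion> y" "y \<sqsubseteq>\<^bsub>M\<lparr>carrier := S\<rparr>\<^esub> x \<squnion> y"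
    using c by (simp_all add: join_left join_right)
  show "x \<squnion> y \<sqsubseteq>\<^bsub>M\<lparr>carrier := S\<rparr>\<^esub> w"
    if "w \<in> carrier (M\<lparr>carrier := S\<rparr>)" "x \<sqsubseteq>\<^bsub>M\<lparr>carrier := S\<rparr>\<^esub> w" "y \<sqsubseteq>\<^bsub>M\<lparr>carrier := S\<rparr>\<^esub> w" for w
    using that c assms(1) by (auto intro: join_le)
qed (use assms in auto)

lemma sub_meet:
  assumes "S \<subseteq> carrier M" "x \<in> S" "y \<in> S" "x \<sqinter> y \<in> S"
  shows "x \<sqinter>\<^bsub>M\<lparr>carrier := S\<rparr>\<^esub> y = x \<sqinter> y"
proof (rule partial_order.meet_eqI[OF partial_order_subset[OF assms(1)]])
  have c: "x \<in> carrier M" "y \<in> carrier M" using assms by auto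
  show "x \<sqinter> y \<sqsubseteq>\<^bsub>M\<lparr>carrier := S\<rparr>\<^esub> x" "x \<sqinter> y \<sqsubseteq>\<^bsub>M\<lparr>carrier := S\<rparr>\<^esub> y"
    using c by (simp_all add: meet_left meet_right)
  show "w \<sqsubseteq>\<^bsub>M\<lparr>carrier := S\<rparr>\<^esub> x \<sqinter> y"
    if "w \<in> carrier (M\<lparr>carrier := S\<rparr>)" "w \<sqsubseteq>\<^bsub>M\<lparr>carrier := S\<rparr>\<^esub> x" "w \<sqsubseteq>\<^bsub>M\<lparr>carrier := S\<rparr>\<^esub> y" for w
    using that c assms(1) by (auto intro: meet_le)
qed (use assms in auto)

section \<open>The open elements as a bounded distributive lattice\<close>

lemma open_frame_simps:
  "carrier (open_frame M) = mt_opens M"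
  "le (open_frame M) = le M"
  "\<lbrakk>u \<in> mt_opens M; v \<in> mt_opens M\<rbrakk> \<Longrightarrow> u \<squnion>\<^bsub>open_frame M\<^esub> v = u \<squnion> v"
  "\<lbrakk>u \<in> mt_opens M; v \<in> mt_opens M\<rbrakk> \<Longrightarrow> u \<sqinter>\<^bsub>open_frame M\<^esub> v = u \<sqinter> v"
  by (simp_all add: open_frame_def sub_join sub_meet opens_carrier open_join open_meet)

lemma open_frame_least: "least (open_frame M) \<bottom> (carrier (open_frame M))"
  and open_frame_greatest: "greatest (open_frame M) \<top> (carrier (open_frame M))"
  by (auto simp: least_def greatest_def open_frame_simps open_top open_bottom open_carrier)

lemma partial_order_open_frame: "partial_order (open_frame M)"
  unfolding open_frame_def by (rule partial_order_subset[OF opens_carrier])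

lemma open_frame_top: "\<top>\<^bsub>open_frame M\<^esub> = \<top>"
  by (rule partial_order.top_eqI[OF partial_order_open_frame open_frame_greatest])

lemma bounded_distributive_lattice_open_frame: "bounded_distributive_lattice (open_frame M)"
proof -
  interpret O: partial_order "open_frame M" by (rule partial_order_open_frame)
  show ?thesis
  proof
    fix u v assume "u \<in> carrier (open_frame M)" "v \<in> carrier (open_frame M)"
    then have uv: "u \<in> mt_opens M" "v \<in> mt_opens M" by (simp_all add: open_frame_simps)
    note c = open_carrier[OF uv(1)] open_carrier[OF uv(2)]
    have "is_lub (open_frame M) (u \<squnion> v) {u, v}"
      by (rule least_UpperI)
        (use uv c in \<open>auto simp: open_frame_simps Upper_def open_join open_carrier
          intro: join_left join_right join_le\<close>)
    then show "\<exists>s. is_lub (open_frame M) s {u, v}" ..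
    have "is_glb (open_frame M) (u \<sqinter> v) {u, v}"
      by (rule greatest_LowerI)
        (use uv c in \<open>auto simp: open_frame_simps Lower_def open_meet open_carrier
          intro: meet_left meet_right meet_le\<close>)
    then show "\<exists>s. is_glb (open_frame M) s {u, v}" ..
  next
    fix x y z assume "x \<in> carrier (open_frame M)" "y \<in> carrier (open_frame M)" "z \<in> carrier (open_frame M)"
    then show "x \<sqinter>\<^bsub>open_frame M\<^esub> (y \<squnion>\<^bsub>open_frame M\<^esub> z)
      = (x \<sqinter>\<^bsub>open_frame M\<^esub> y) \<squnion>\<^bsub>open_frame M\<^esub> (x \<sqinter>\<^bsub>open_frame M\<^esub> z)"
      by (simp add: open_frame_simps open_join open_meet open_carrier meet_join_distrib)
  qed (use open_frame_least open_frame_greatest in blast)+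
qed

end

section \<open>The Wallman extension\<close>

context mt_algebra
begin

section \<open>Proper filters of closed elements\<close>

abbreviation X :: "'a set set" where
  "X \<equiv> wallman_filters M"

abbreviation \<sigma> :: "'a \<Rightarrow> 'a set set" where
  "\<sigma> \<equiv> wallman_sigma M"

text \<open>For an upward closed set of closed elements, being nonempty amounts to containing
  \<open>\<top>\<close>, and being proper to omitting \<open>\<bottom>\<close>; meets of closed
  elements are those of \<open>M\<close>.\<close>

lemma wallman_filters_iff:
  "F \<in> X \<longleftrightarrow> F \<subseteq> mt_closeds M \<and> \<top> \<in> F \<and> \<bottom> \<notin> F \<and>
    (\<forall>x \<in> F. \<forall>y \<in> mt_closeds M. x \<sqsubseteq> y \<longrightarrow> y \<in> F) \<and> (\<forall>x \<in> F. \<forall>y \<in> F. x \<sqinter> y \<in> F)"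
proof (cases "F \<subseteq> mt_closeds M")
  case sub: True
  have meet: "x \<sqinter>\<^bsub>M\<lparr>carrier := mt_closeds M\<rparr>\<^esub> y = x \<sqinter> y" if "x \<in> F" "y \<in> F" for x y
    using sub_meet[OF closeds_carrier, of x y] that sub closed_meet by auto
  show ?thesis
  proof (cases "\<forall>x \<in> F. \<forall>y \<in> mt_closeds M. x \<sqsubseteq> y \<longrightarrow> y \<in> F")
    case True
    have "F \<noteq> {} \<longleftrightarrow> \<top> \<in> F"
      using True sub closed_top closed_carrier top_higher by blast
    moreover have "F \<noteq> mt_closeds M \<longleftrightarrow> \<bottom> \<notin> F"
      using True sub closed_bottom closed_carrier bottom_lower by blast
    ultimately show ?thesis
      unfolding wallman_filters_def proper_filters_def using True sub meet by auto
  next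
    case False
    then show ?thesis unfolding wallman_filters_def proper_filters_def by auto
  qed
next
  case False
  then show ?thesis unfolding wallman_filters_def proper_filters_def by auto
qed

lemma wallman_filterI:
  assumes "F \<subseteq> mt_closeds M" "\<top> \<in> F" "\<bottom> \<notin> F"
    and "\<And>x y. \<lbrakk>x \<in> F; y \<in> mt_closeds M; x \<sqsubseteq> y\<rbrakk> \<Longrightarrow> y \<in> F"
    and "\<And>x y. \<lbrakk>x \<in> F; y \<in> F\<rbrakk> \<Longrightarrow> x \<sqinter> y \<in> F"
  shows "F \<in> X"
  using assms unfolding wallman_filters_iff by blast

lemma wallman_filterD:
  assumes "F \<in> X"
  shows "\<And>x. x \<in> F \<Longrightarrow> x \<in> mt_closeds M" "\<top> \<in> F" "\<bottom> \<notin> F"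
    and "\<And>x y. \<lbrakk>x \<in> F; y \<in> mt_closeds M; x \<sqsubseteq> y\<rbrakk> \<Longrightarrow> y \<in> F"
    and "\<And>x y. \<lbrakk>x \<in> F; y \<in> F\<rbrakk> \<Longrightarrow> x \<sqinter> y \<in> F"
  using assms unfolding wallman_filters_iff by blast+

text \<open>The filter generated by \<open>y\<close> and \<open>b\<close> is proper since
  \<open>b\<close> meets every member of \<open>y\<close>. Each of its elements lies above a single
  \<open>b \<sqinter> d\<close>, because \<open>y\<close> is closed under meets.\<close>

lemma filter_extend:
  assumes y: "y \<in> X" and b: "b \<in> mt_closeds M" and ne: "\<And>d. d \<in> y \<Longrightarrow> b \<sqinter> d \<noteq> \<bottom>"
  obtains z where "z \<in> X" "y \<subseteq> z" "b \<in> z"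
proof
  note yD = wallman_filterD[OF y]
  let ?z = "{c \<in> mt_closeds M. \<exists>d \<in> y. b \<sqinter> d \<sqsubseteq> c}"
  have bc: "b \<in> carrier M" using b by (rule closed_carrier)
  have dc: "d \<in> carrier M" if "d \<in> y" for d using yD(1)[OF that] by (rule closed_carrier)
  show "?z \<in> X"
  proof (rule wallman_filterI)
    show "\<top> \<in> ?z" using yD(2) closed_top bc by (auto intro!: bexI[of _ \<top>])
    show "\<bottom> \<notin> ?z"
    proof
      assume "\<bottom> \<in> ?z"
      then obtain d where d: "d \<in> y" "b \<sqinter> d \<sqsubseteq> \<bottom>" by auto
      then have "b \<sqinter> d = \<bottom>" using bc dc[OF d(1)] by (intro le_antisym) auto
      then show False using ne[OF d(1)] by simp
    qed
    show "c' \<in> ?z" if "c \<in> ?z" "c' \<in> mt_closeds M" "c \<sqsubseteq> c'" for c c'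
    proof -
      obtain d where d: "d \<in> y" "b \<sqinter> d \<sqsubseteq> c" "c \<in> mt_closeds M" using \<open>c \<in> ?z\<close> by auto
      have "b \<sqinter> d \<sqsubseteq> c'"
        by (rule le_trans[OF d(2) that(3)]) (use d that bc dc in \<open>simp_all add: closed_carrier\<close>)
      then show ?thesis using d that by auto
    qed
    show "c \<sqinter> c' \<in> ?z" if c: "c \<in> ?z" and c': "c' \<in> ?z" for c c'
    proof -
      obtain d where d: "d \<in> y" "b \<sqinter> d \<sqsubseteq> c" "c \<in> mt_closeds M" using c by auto
      obtain d' where d': "d' \<in> y" "b \<sqinter> d' \<sqsubseteq> c'" "c' \<in> mt_closeds M" using c' by auto
      note car = bc dc[OF d(1)] dc[OF d'(1)] closed_carrier[OF d(3)] closed_carrier[OF d'(3)]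
      have "d \<sqinter> d' \<sqsubseteq> d" "d \<sqinter> d' \<sqsubseteq> d'" using car by (simp_all add: meet_left meet_right)
      then have "b \<sqinter> (d \<sqinter> d') \<sqsubseteq> b \<sqinter> d" "b \<sqinter> (d \<sqinter> d') \<sqsubseteq> b \<sqinter> d'"
        using car by (meson meet_closed meet_le meet_left meet_right le_trans)+
      then have "b \<sqinter> (d \<sqinter> d') \<sqsubseteq> c" "b \<sqinter> (d \<sqinter> d') \<sqsubseteq> c'"
        using car d(2) d'(2) by (meson meet_closed le_trans)+
      then have "b \<sqinter> (d \<sqinter> d') \<sqsubseteq> c \<sqinter> c'" using car by (simp add: meet_le)
      then show ?thesis using yD(5)[OF d(1) d'(1)] closed_meet[OF d(3) d'(3)] by auto
    qed
  qed auto
  show "y \<subseteq> ?z"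
    using yD(1) bc dc by (auto intro!: bexI meet_right)
  show "b \<in> ?z"
    using b bc yD(2) by (auto intro!: bexI[of _ \<top>] meet_left)
qed

text \<open>For open \<open>u\<close>, an element disjoint from \<open>u\<close> lies below the
  closed element \<open>neg u\<close>, which then belongs to the filter by upward closure.
  Compatibility with all members thus reduces to one missing element.\<close>

lemma sigma_open:
  assumes u: "u \<in> mt_opens M"
  shows "\<sigma> u = pseudo_compl X {y \<in> X. neg u \<in> y}"
proof -
  note c = open_carrier[OF u] neg_closed[OF open_carrier[OF u]]
  have "(\<forall>b \<in> y. u \<sqinter> b \<noteq> \<bottom>) \<longleftrightarrow> neg u \<notin> y" if y: "y \<in> X" for y
  proof -
    have "u \<sqinter> b = \<bottom> \<longleftrightarrow> b \<sqsubseteq> neg u" if "b \<in> y" for b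
      using le_iff_meet_neg[of b "neg u"] c closed_carrier[OF wallman_filterD(1)[OF y that]]
      by (simp add: neg_neg meet_comm)
    then show ?thesis
      using wallman_filterD(4)[OF y _ neg_open[OF u]] c(2) by (metis le_refl)
  qed
  then show ?thesis unfolding wallman_sigma_def pseudo_compl_def by blast
qed

lemma sigma_open_iff:
  "u \<in> mt_opens M \<Longrightarrow> x \<in> \<sigma> u \<longleftrightarrow> x \<in> X \<and> (\<forall>y \<in> X. x \<subseteq> y \<longrightarrow> neg u \<notin> y)"
  by (auto simp: sigma_open pseudo_compl_def)

lemma sigma_regular: "u \<in> mt_opens M \<Longrightarrow> \<sigma> u \<in> regular_upsets X"
  unfolding sigma_open by (rule pseudo_compl_regular) (auto simp: upsets_iff)

text \<open>A closed \<open>b\<close> is compatible with every extension of \<open>x\<close> exactly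
  when each extension can be enlarged to contain \<open>b\<close> (by \<open>filter_extend\<close>),
  that is, when none of them lies in \<open>\<sigma> (neg b)\<close>.\<close>

lemma sigma_closed:
  assumes b: "b \<in> mt_closeds M"
  shows "\<sigma> b = pseudo_compl X (\<sigma> (neg b))"
proof -
  have o: "neg b \<in> mt_opens M" using b by (rule neg_closed_open)
  have nn: "neg (neg b) = b" using closed_carrier[OF b] by (rule neg_neg)
  show ?thesis
  proof (intro equalityI subsetI)
    fix x assume x: "x \<in> \<sigma> b"
    have "y \<notin> \<sigma> (neg b)" if y: "y \<in> X" "x \<subseteq> y" for y
    proof -
      have "b \<sqinter> d \<noteq> \<bottom>" if "d \<in> y" for d using x y that by (simp add: wallman_sigma_def)
      then obtain z where "z \<in> X" "y \<subseteq> z" "b \<in> z" using filter_extend[OF y(1) b] by metis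
      then show ?thesis unfolding sigma_open_iff[OF o] nn by auto
    qed
    then show "x \<in> pseudo_compl X (\<sigma> (neg b))"
      using x by (simp add: wallman_sigma_def pseudo_compl_def)
  next
    fix x assume x: "x \<in> pseudo_compl X (\<sigma> (neg b))"
    have "b \<sqinter> c \<noteq> \<bottom>" if y: "y \<in> X" "x \<subseteq> y" "c \<in> y" for y c
    proof -
      have "y \<notin> \<sigma> (neg b)" using x y by (simp add: pseudo_compl_def)
      then obtain z where z: "z \<in> X" "y \<subseteq> z" "b \<in> z"
        using y(1) unfolding sigma_open_iff[OF o] nn by auto
      then have "b \<sqinter> c \<in> z" using wallman_filterD(5)[OF z(1)] y(3) by auto
      then show ?thesis using wallman_filterD(3)[OF z(1)] by auto
    qed
    then show "x \<in> \<sigma> b" using x by (simp add: wallman_sigma_def pseudo_compl_def)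
  qed
qed

lemma sigma_mono:
  assumes u: "u \<in> mt_opens M" and v: "v \<in> mt_opens M" and le: "u \<sqsubseteq> v"
  shows "\<sigma> u \<subseteq> \<sigma> v"
proof
  fix x assume x: "x \<in> \<sigma> u"
  note c = open_carrier[OF u] open_carrier[OF v]
  have "neg v \<sqsubseteq> neg u" using le c by (simp add: le_neg_swap neg_closed neg_neg)
  then have "neg u \<in> y" if "y \<in> X" "neg v \<in> y" for y
    using wallman_filterD(4)[OF that(1) that(2) neg_open[OF u]] by simp
  then show "x \<in> \<sigma> v" using x unfolding sigma_open_iff[OF u] sigma_open_iff[OF v] by blast
qed

lemma sigma_bottom: "\<sigma> \<bottom> = {}"
  using wallman_filterD(2) by (auto simp: sigma_open_iff[OF open_bottom] neg_bottom)

text \<open>The union of \<open>\<sigma> u\<close> and \<open>\<sigma> v\<close> is dense in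
  \<open>\<sigma> (u \<squnion> v)\<close>, and regularity of \<open>U\<close> turns density into
  inclusion. This makes \<open>sigma_ideal\<close> closed under joins.\<close>

lemma sigma_join:
  assumes u: "u \<in> mt_opens M" and v: "v \<in> mt_opens M"
    and U: "U \<in> regular_upsets X" "\<sigma> u \<subseteq> U" "\<sigma> v \<subseteq> U"
  shows "\<sigma> (u \<squnion> v) \<subseteq> U"
proof
  fix x assume x: "x \<in> \<sigma> (u \<squnion> v)"
  have x': "x \<in> X" "\<And>y. \<lbrakk>y \<in> X; x \<subseteq> y\<rbrakk> \<Longrightarrow> neg u \<sqinter> neg v \<notin> y"
    using x u v by (auto simp: sigma_open_iff open_join neg_join open_carrier)
  show "x \<in> U"
  proof (rule regular_upsetD[OF U(1) x'(1)])
    fix y assume y: "y \<in> X" "x \<subseteq> y"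
    show "\<exists>z \<in> U. y \<subseteq> z"
    proof (cases "y \<in> \<sigma> u")
      case True
      then show ?thesis using U(2) by auto
    next
      case False
      \<comment> \<open>Outside \<open>\<sigma> u\<close> some extension contains
        \<open>neg u\<close>. Nothing above it contains \<open>neg v\<close> as well, since the meet
        of the two is excluded above \<open>x\<close>; so it lies in
        \<open>\<sigma> v\<close>.\<close>
      then obtain z where z: "z \<in> X" "y \<subseteq> z" "neg u \<in> z"
        using y(1) unfolding sigma_open_iff[OF u] by auto
      have "neg v \<notin> z'" if z': "z' \<in> X" "z \<subseteq> z'" for z'
        using x'(2)[of z'] wallman_filterD(5)[OF z'(1), of "neg u" "neg v"] z' z y by auto
      then have "z \<in> \<sigma> v" using z(1) unfolding sigma_open_iff[OF v] by auto
      then show ?thesis using U(3) z(2) by auto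
    qed
  qed
qed

section \<open>Joins of sets \<open>\<sigma> u\<close> and the open elements of the Wallman
  extension\<close>

definition open_join_sigma :: "'a set \<Rightarrow> 'a set set" where
  "open_join_sigma T = pseudo_compl X (pseudo_compl X (\<Union>u \<in> T. \<sigma> u))"

lemma sigma_UN_upset: "T \<subseteq> mt_opens M \<Longrightarrow> (\<Union>u \<in> T. \<sigma> u) \<in> upsets X"
  by (rule upsets_UN) (auto intro: regular_upset sigma_regular)

lemma open_join_sigma_regular: "T \<subseteq> mt_opens M \<Longrightarrow> open_join_sigma T \<in> regular_upsets X"
  unfolding open_join_sigma_def
  by (intro pseudo_compl_regular regular_upset sigma_UN_upset)

lemma sigma_subset_open_join:
  assumes "T \<subseteq> mt_opens M" "u \<in> T"
  shows "\<sigma> u \<subseteq> open_join_sigma T"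
  using subset_double_pseudo_compl[OF sigma_UN_upset[OF assms(1)]] assms(2)
  unfolding open_join_sigma_def by auto

text \<open>With \<open>sigma_subset_open_join\<close>, this characterizes
  \<open>open_join_sigma T\<close>, for a set \<open>T\<close> of opens, as the join of the sets
  \<open>\<sigma> u\<close> in the regular open algebra.\<close>

lemma open_join_sigma_least:
  "\<lbrakk>\<And>u. u \<in> T \<Longrightarrow> \<sigma> u \<subseteq> U; U \<in> regular_upsets X\<rbrakk> \<Longrightarrow> open_join_sigma T \<subseteq> U"
  unfolding open_join_sigma_def by (rule double_pseudo_compl_subset) auto

lemma neg_image_closeds: "neg ` mt_closeds M = mt_opens M"
proof
  show "mt_opens M \<subseteq> neg ` mt_closeds M"
  proof
    fix u assume u: "u \<in> mt_opens M"
    then have "u = neg (neg u)" by (simp add: neg_neg open_carrier)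
    then show "u \<in> neg ` mt_closeds M" using neg_open[OF u] by (rule image_eqI)
  qed
qed (auto intro: neg_closed_open)

text \<open>By \<open>sigma_closed\<close>, a meet of sets \<open>\<sigma> b\<close> with
  \<open>b\<close> closed is the pseudocomplement of a union of sets
  \<open>\<sigma> (neg b)\<close>. Complementing once more yields the regularization of that
  union.\<close>

lemma wallman_opens_eq: "wallman_opens M = open_join_sigma ` Pow (mt_opens M)"
proof -
  have Inf: "\<Sqinter>\<^bsub>RO_algebra X\<^esub>(\<sigma> ` B) = pseudo_compl X (\<Union>u \<in> neg ` B. \<sigma> u)"
    if B: "B \<subseteq> mt_closeds M" for B
  proof -
    have s: "\<sigma> b = pseudo_compl X (\<sigma> (neg b))" if "b \<in> B" for b
      using sigma_closed B that by auto
    have "\<sigma> ` B \<subseteq> regular_upsets X"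
      using s B by (auto intro!: pseudo_compl_regular regular_upset sigma_regular neg_closed_open)
    then have "\<Sqinter>\<^bsub>RO_algebra X\<^esub>(\<sigma> ` B) = X \<inter> \<Inter>(\<sigma> ` B)" by (rule RO_Inf)
    also have "\<dots> = X \<inter> (\<Inter>b \<in> B. pseudo_compl X (\<sigma> (neg b)))"
      using s by simp
    finally show ?thesis by (simp add: pseudo_compl_UN image_image)
  qed
  have "wallman_closeds M = (\<lambda>B. \<Sqinter>\<^bsub>RO_algebra X\<^esub>(\<sigma> ` B)) ` Pow (mt_closeds M)"
    unfolding wallman_closeds_def by (auto simp: subset_image_iff)
  also have "\<dots> = (\<lambda>B. pseudo_compl X (\<Union>u \<in> neg ` B. \<sigma> u)) ` Pow (mt_closeds M)"
    using Inf by (intro image_cong) auto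
  \<comment> \<open>The families are reindexed: taking images under \<open>neg\<close> maps the sets
    of closeds onto the sets of opens.\<close>
  also have "\<dots> = (\<lambda>T. pseudo_compl X (\<Union>u \<in> T. \<sigma> u)) ` Pow (mt_opens M)"
    unfolding neg_image_closeds[symmetric] image_Pow_surj[OF HOL.refl, symmetric] by (simp add: image_image)
  finally have closeds: "wallman_closeds M = (\<lambda>T. pseudo_compl X (\<Union>u \<in> T. \<sigma> u)) ` Pow (mt_opens M)" .
  show ?thesis
    unfolding wallman_opens_def closeds image_image
    by (rule image_cong)
      (auto simp: open_join_sigma_def intro!: RO_compl pseudo_compl_regular sigma_UN_upset)
qed

text \<open>\<open>wallman_box\<close> is a definite description of the greatest open below its
  argument, so its existence has to be established first. The fixed points are then the elements of
  \<open>wallman_opens M\<close>.\<close>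

lemma opens_wallman_extension: "mt_opens (wallman_extension M) = wallman_opens M"
proof -
  \<comment> \<open>The greatest open below \<open>A\<close> regularizes the union of all
    \<open>\<sigma> u\<close> inside \<open>A\<close>; any other open below \<open>A\<close> is
    generated by some of these.\<close>
  have "greatest (RO_algebra X) (open_join_sigma {u \<in> mt_opens M. \<sigma> u \<subseteq> A})
      {V \<in> wallman_opens M. V \<subseteq> A}" if A: "A \<in> regular_upsets X" for A
    unfolding greatest_def
  proof (intro conjI ballI)
    show "{V \<in> wallman_opens M. V \<subseteq> A} \<subseteq> carrier (RO_algebra X)"
      by (auto simp: wallman_opens_eq carrier_RO intro: open_join_sigma_regular)
    show "open_join_sigma {u \<in> mt_opens M. \<sigma> u \<subseteq> A} \<in> {V \<in> wallman_opens M. V \<subseteq> A}"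
      using open_join_sigma_least[OF _ A, of "{u \<in> mt_opens M. \<sigma> u \<subseteq> A}"]
      by (auto simp: wallman_opens_eq)
    fix V assume V: "V \<in> {V \<in> wallman_opens M. V \<subseteq> A}"
    then obtain T where T: "T \<subseteq> mt_opens M" "V = open_join_sigma T" "V \<subseteq> A"
      by (auto simp: wallman_opens_eq)
    have "\<sigma> u \<subseteq> open_join_sigma {u \<in> mt_opens M. \<sigma> u \<subseteq> A}" if "u \<in> T" for u
    proof (rule sigma_subset_open_join)
      show "u \<in> {u \<in> mt_opens M. \<sigma> u \<subseteq> A}"
        using sigma_subset_open_join[OF T(1) that] T that by auto
    qed auto
    then show "V \<sqsubseteq>\<^bsub>RO_algebra X\<^esub> open_join_sigma {u \<in> mt_opens M. \<sigma> u \<subseteq> A}"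
      unfolding T(2) using open_join_sigma_least[OF _ open_join_sigma_regular]
      by (simp add: RO_algebra_def)
  qed
  then have box: "greatest (RO_algebra X) (wallman_box M A) {V \<in> wallman_opens M. V \<subseteq> A}"
    if "A \<in> regular_upsets X" for A
    unfolding wallman_box_def
    using that partial_order.greatest_unique[OF partial_order_RO] by (metis (no_types, lifting) theI)
  have "wallman_box M A \<in> wallman_opens M" if "A \<in> regular_upsets X" for A
    using greatest_mem[OF box[OF that]] by simp
  moreover have "A = wallman_box M A" if "A \<in> wallman_opens M" for A
  proof
    have A: "A \<in> regular_upsets X"
      using that by (auto simp: wallman_opens_eq intro: open_join_sigma_regular)
    show "wallman_box M A \<subseteq> A" using greatest_mem[OF box[OF A]] by simp
    show "A \<subseteq> wallman_box M A" using greatest_le[OF box[OF A], of A] that by (simp add: RO_algebra_def)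
  qed
  moreover have "wallman_opens M \<subseteq> regular_upsets X"
    by (auto simp: wallman_opens_eq intro: open_join_sigma_regular)
  ultimately show ?thesis
    unfolding mt_opens_def by (auto simp: wallman_extension_def) metis+
qed

section \<open>The isomorphism\<close>

definition sigma_ideal :: "'a set set \<Rightarrow> 'a set" where
  "sigma_ideal U = {u \<in> mt_opens M. \<sigma> u \<subseteq> U}"

lemma wallman_opens_regular: "U \<in> wallman_opens M \<Longrightarrow> U \<in> regular_upsets X"
  by (auto simp: wallman_opens_eq intro: open_join_sigma_regular)

text \<open>An open element is generated by sets \<open>\<sigma> u\<close>, all of which its ideal
  records; hence the ideal determines it and its place in the order.\<close>

lemma sigma_ideal_le_iff:
  assumes U: "U \<in> wallman_opens M" and V: "V \<in> wallman_opens M"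
  shows "U \<subseteq> V \<longleftrightarrow> sigma_ideal U \<subseteq> sigma_ideal V"
proof
  assume *: "sigma_ideal U \<subseteq> sigma_ideal V"
  obtain T where T: "T \<subseteq> mt_opens M" "U = open_join_sigma T"
    using U by (auto simp: wallman_opens_eq)
  have "\<sigma> u \<subseteq> V" if "u \<in> T" for u
  proof -
    have "u \<in> sigma_ideal U"
      using sigma_subset_open_join[OF T(1) that] T that by (auto simp: sigma_ideal_def)
    then show ?thesis using * by (auto simp: sigma_ideal_def)
  qed
  then show "U \<subseteq> V"
    unfolding T(2) using open_join_sigma_least wallman_opens_regular[OF V] by blast
qed (auto simp: sigma_ideal_def)

interpretation O: bounded_distributive_lattice "open_frame M"
  by (rule bounded_distributive_lattice_open_frame)

text \<open>A cover \<open>a \<squnion> w = \<top>\<close> of opens is an inequality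
  \<open>neg w \<sqsubseteq> a\<close> in \<open>M\<close>. As \<open>neg w\<close> ranges over the
  closeds, the condition says that each closed element below \<open>a\<close> lies below a member of
  \<open>I\<close>.\<close>

lemma suited_closure_open_iff:
  "a \<in> O.suited_closure I \<longleftrightarrow>
    a \<in> mt_opens M \<and> (\<forall>w \<in> mt_opens M. neg w \<sqsubseteq> a \<longrightarrow> (\<exists>i \<in> I. neg w \<sqsubseteq> i))"
  if "I \<subseteq> mt_opens M"
proof -
  have "u \<squnion>\<^bsub>open_frame M\<^esub> w = \<top>\<^bsub>open_frame M\<^esub> \<longleftrightarrow> neg w \<sqsubseteq> u"
    if "u \<in> mt_opens M" "w \<in> mt_opens M" for u w
    using that join_top_iff[of w u] by (simp add: open_frame_simps open_frame_top open_carrier join_comm)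
  then show ?thesis
    unfolding O.suited_closure_def open_frame_simps using that by (auto simp: subset_iff)
qed

text \<open>For \<open>u\<close> in the closure, every filter above a point of
  \<open>\<sigma> u\<close> lies in \<open>U\<close>; regularity then gives
  \<open>\<sigma> u \<subseteq> U\<close>.\<close>

lemma sigma_ideal_suited:
  assumes U: "U \<in> regular_upsets X"
  shows "sigma_ideal U \<in> carrier (wallman_frame (open_frame M))"
proof -
  have sub: "sigma_ideal U \<subseteq> mt_opens M" by (auto simp: sigma_ideal_def)
  have id: "sigma_ideal U \<in> lattice_ideals (open_frame M)"
    unfolding lattice_ideals_def open_frame_simps
  proof (intro CollectI conjI ballI impI)
    show "sigma_ideal U \<noteq> {}"
      using open_bottom sigma_bottom by (auto simp: sigma_ideal_def)
    show "v \<in> sigma_ideal U" if "u \<in> sigma_ideal U" "v \<in> mt_opens M" "v \<sqsubseteq> u" for u v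
      using that sigma_mono[of v u] by (auto simp: sigma_ideal_def)
    show "u \<squnion>\<^bsub>open_frame M\<^esub> v \<in> sigma_ideal U" if "u \<in> sigma_ideal U" "v \<in> sigma_ideal U" for u v
      using that sigma_join[OF _ _ U] by (auto simp: sigma_ideal_def open_frame_simps open_join)
  qed (rule sub)
  have "u \<in> sigma_ideal U" if su: "u \<in> O.suited_closure (sigma_ideal U)" for u
  proof -
    have u: "u \<in> mt_opens M"
      and closure: "\<And>w. \<lbrakk>w \<in> mt_opens M; neg w \<sqsubseteq> u\<rbrakk> \<Longrightarrow> \<exists>i \<in> sigma_ideal U. neg w \<sqsubseteq> i"
      using su unfolding suited_closure_open_iff[OF sub] by auto
    note uc = open_carrier[OF u] neg_closed[OF open_carrier[OF u]]
    have "x \<in> U" if x: "x \<in> \<sigma> u" for x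
    proof (rule regular_upsetD[OF U])
      show "x \<in> X" using x by (simp add: sigma_open_iff[OF u])
      fix y assume y: "y \<in> X" "x \<subseteq> y"
      \<comment> \<open>Otherwise \<open>y\<close> extends to a filter containing
        \<open>neg u\<close>, which membership of \<open>x\<close> in \<open>\<sigma> u\<close>
        forbids. The \<open>c\<close> obtained is a closed element below \<open>u\<close>, to which
        the closure condition applies.\<close>
      have "\<exists>c \<in> y. neg u \<sqinter> c = \<bottom>"
      proof (rule ccontr)
        assume "\<not> ?thesis"
        then obtain z where "z \<in> X" "y \<subseteq> z" "neg u \<in> z"
          using filter_extend[OF y(1) neg_open[OF u]] by metis
        then show False using x y unfolding sigma_open_iff[OF u] by (meson order_trans)
      qed
      then obtain c where c: "c \<in> y" "neg u \<sqinter> c = \<bottom>" by auto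
      have cc: "c \<in> mt_closeds M" using wallman_filterD(1)[OF y(1) c(1)] .
      note ccar = closed_carrier[OF cc]
      have "c \<sqsubseteq> u" using c(2) uc ccar by (simp add: le_iff_meet_neg meet_comm)
      then obtain i where i: "i \<in> sigma_ideal U" "c \<sqsubseteq> i"
        using closure[OF neg_closed_open[OF cc]] ccar by (auto simp: neg_neg)
      have io: "i \<in> mt_opens M" using i(1) by (simp add: sigma_ideal_def)
      note ic = open_carrier[OF io]
      \<comment> \<open>Since \<open>c\<close> lies in \<open>y\<close> and below \<open>i\<close>,
        no filter above \<open>y\<close> contains \<open>neg i\<close>; hence \<open>y\<close> lies
        in \<open>\<sigma> i\<close>, inside \<open>U\<close>.\<close>
      have "neg i \<notin> z" if z: "z \<in> X" "y \<subseteq> z" for z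
      proof
        assume "neg i \<in> z"
        then have "c \<sqinter> neg i \<in> z" using wallman_filterD(5)[OF z(1)] c(1) z(2) by auto
        then show False
          using wallman_filterD(3)[OF z(1)] i(2) ic ccar by (simp add: le_iff_meet_neg)
      qed
      then have "y \<in> \<sigma> i" using y(1) by (simp add: sigma_open_iff[OF io])
      then show "\<exists>z \<in> U. y \<subseteq> z" using i(1) by (auto simp: sigma_ideal_def)
    qed
    then show ?thesis using u by (auto simp: sigma_ideal_def)
  qed
  then have "O.suited_closure (sigma_ideal U) = sigma_ideal U"
    using O.subset_suited_closure[OF id] by auto
  then show ?thesis using id O.suited_ideals by (simp add: wallman_frame_def)
qed

text \<open>Suitedness of \<open>I\<close> reduces the inclusion into \<open>I\<close> to this:
  every closed element below \<open>u\<close> lies below a single member of \<open>I\<close>. A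
  counterexample would yield a filter in \<open>\<sigma> u\<close> outside the regularized
  union.\<close>

lemma sigma_ideal_surj:
  assumes I: "I \<in> carrier (wallman_frame (open_frame M))"
  shows "sigma_ideal (open_join_sigma I) = I"
proof -
  have id: "I \<in> lattice_ideals (open_frame M)" and s: "O.suited_closure I = I"
    using I O.suited_ideals by (auto simp: wallman_frame_def)
  have sub: "I \<subseteq> mt_opens M" using O.lattice_idealsD(1)[OF id] by (simp add: open_frame_simps)
  have join: "i \<squnion> j \<in> I" if "i \<in> I" "j \<in> I" for i j
    using O.lattice_idealsD(4)[OF id that] that sub by (auto simp: open_frame_simps subset_iff)
  have ne: "I \<noteq> {}" by (rule O.lattice_idealsD(2)[OF id])
  have ic: "i \<in> carrier M" "neg i \<in> carrier M" "neg i \<in> mt_closeds M" if "i \<in> I" for i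
    using sub that by (auto simp: open_carrier neg_closed intro!: neg_open)
  show ?thesis
  proof (intro equalityI subsetI)
    fix i assume "i \<in> I"
    then show "i \<in> sigma_ideal (open_join_sigma I)"
      using sigma_subset_open_join[OF sub] sub by (auto simp: sigma_ideal_def)
  next
    fix u assume "u \<in> sigma_ideal (open_join_sigma I)"
    then have u: "u \<in> mt_opens M" and su: "\<sigma> u \<subseteq> open_join_sigma I" by (auto simp: sigma_ideal_def)
    have "\<exists>i \<in> I. neg w \<sqsubseteq> i" if w: "w \<in> mt_opens M" "neg w \<sqsubseteq> u" for w
    proof (rule ccontr)
      assume contra: "\<not> ?thesis"
      let ?c = "neg w"
      have cc: "?c \<in> mt_closeds M" by (rule neg_open[OF w(1)])
      have ccar: "?c \<in> carrier M" by (rule closed_carrier[OF cc])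
      \<comment> \<open>The filter generated by \<open>?c\<close> and the complements of members of
        \<open>I\<close>. One \<open>i\<close> at a time suffices because \<open>I\<close> is closed
        under joins, and \<open>contra\<close> keeps the filter proper.\<close>
      let ?F = "{d \<in> mt_closeds M. \<exists>i \<in> I. ?c \<sqinter> neg i \<sqsubseteq> d}"
      have F: "?F \<in> X"
      proof (rule wallman_filterI)
        show "\<top> \<in> ?F" using ne ic ccar closed_top by auto
        show "\<bottom> \<notin> ?F"
        proof
          assume "\<bottom> \<in> ?F"
          then obtain i where i: "i \<in> I" "?c \<sqinter> neg i \<sqsubseteq> \<bottom>" by auto
          then have "?c \<sqinter> neg i = \<bottom>" using ic[OF i(1)] ccar by (intro le_antisym) auto
          then have "?c \<sqsubseteq> i" using ic[OF i(1)] ccar by (simp add: le_iff_meet_neg)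
          then show False using contra i(1) by auto
        qed
        show "d' \<in> ?F" if "d \<in> ?F" "d' \<in> mt_closeds M" "d \<sqsubseteq> d'" for d d'
        proof -
          obtain i where i: "i \<in> I" "?c \<sqinter> neg i \<sqsubseteq> d" "d \<in> mt_closeds M" using \<open>d \<in> ?F\<close> by auto
          have "?c \<sqinter> neg i \<sqsubseteq> d'"
            by (rule le_trans[OF i(2) that(3)])
              (use i that ic ccar in \<open>simp_all add: closed_carrier\<close>)
          then show ?thesis using i that by auto
        qed
        show "d \<sqinter> d' \<in> ?F" if d: "d \<in> ?F" and d': "d' \<in> ?F" for d d'
        proof -
          obtain i where i: "i \<in> I" "?c \<sqinter> neg i \<sqsubseteq> d" "d \<in> mt_closeds M" using d by auto
          obtain j where j: "j \<in> I" "?c \<sqinter> neg j \<sqsubseteq> d'" "d' \<in> mt_closeds M" using d' by auto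
          note car = ccar ic(1,2)[OF i(1)] ic(1,2)[OF j(1)] closed_carrier[OF i(3)] closed_carrier[OF j(3)]
          have eq: "neg (i \<squnion> j) = neg i \<sqinter> neg j" using car by (simp add: neg_join)
          have "neg i \<sqinter> neg j \<sqsubseteq> neg i" "neg i \<sqinter> neg j \<sqsubseteq> neg j"
            using car by (simp_all add: meet_left meet_right)
          then have "?c \<sqinter> (neg i \<sqinter> neg j) \<sqsubseteq> ?c \<sqinter> neg i" "?c \<sqinter> (neg i \<sqinter> neg j) \<sqsubseteq> ?c \<sqinter> neg j"
            using car by (meson meet_closed meet_le meet_left meet_right le_trans)+
          then have "?c \<sqinter> (neg i \<sqinter> neg j) \<sqsubseteq> d" "?c \<sqinter> (neg i \<sqinter> neg j) \<sqsubseteq> d'"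
            using car i(2) j(2) by (meson meet_closed le_trans)+
          then have "?c \<sqinter> neg (i \<squnion> j) \<sqsubseteq> d \<sqinter> d'" unfolding eq using car by (simp add: meet_le)
          then show ?thesis using join[OF i(1) j(1)] closed_meet[OF i(3) j(3)] by auto
        qed
      qed auto
      have cF: "?c \<in> ?F" using ne ic ccar cc meet_left[OF ccar] by auto
      have iF: "neg i \<in> ?F" if "i \<in> I" for i
        using that ic[OF that] meet_right[OF ccar ic(2)[OF that]] by blast
      \<comment> \<open>Since \<open>?c\<close> lies below \<open>u\<close>, it is disjoint from
        \<open>neg u\<close>, so no proper filter above \<open>?F\<close> contains
        \<open>neg u\<close>; thus \<open>?F\<close> lies in \<open>\<sigma> u\<close>.\<close>
      have "neg u \<notin> y" if y: "y \<in> X" "?F \<subseteq> y" for y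
      proof
        assume "neg u \<in> y"
        moreover have "?c \<in> y" using cF y(2) by auto
        ultimately have "?c \<sqinter> neg u \<in> y" by (intro wallman_filterD(5)[OF y(1)])
        then show False
          using wallman_filterD(3)[OF y(1)] w(2) ccar open_carrier[OF u] by (simp add: le_iff_meet_neg)
      qed
      then have "?F \<in> \<sigma> u" using F by (simp add: sigma_open_iff[OF u])
      \<comment> \<open>Membership in the regularization gives an extension \<open>z\<close> in some
        \<open>\<sigma> i\<close>, which must omit \<open>neg i\<close>, although \<open>?F\<close>
        already contains it.\<close>
      then have "?F \<in> open_join_sigma I" using su by auto
      then obtain z where z: "z \<in> X" "?F \<subseteq> z" "z \<in> (\<Union>i \<in> I. \<sigma> i)"
        unfolding open_join_sigma_def by (rule double_pseudo_complE)
      then obtain i where i: "i \<in> I" "z \<in> \<sigma> i" by auto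
      then have "neg i \<notin> z" using z(1) sub sigma_open_iff[of i z] by auto
      then show False using iF[OF i(1)] z(2) by auto
    qed
    then have "u \<in> O.suited_closure I" using u unfolding suited_closure_open_iff[OF sub] by auto
    then show "u \<in> I" using s by simp
  qed
qed

lemma sigma_ideal_iso:
  "frame_iso (open_frame (wallman_extension M)) (wallman_frame (open_frame M)) sigma_ideal"
proof (rule frame_isoI)
  have K: "carrier (open_frame (wallman_extension M)) = wallman_opens M"
    "le (open_frame (wallman_extension M)) = (\<subseteq>)" "eq (open_frame (wallman_extension M)) = (=)"
    by (simp_all add: open_frame_def opens_wallman_extension) (simp_all add: wallman_extension_def)
  have L: "le (wallman_frame (open_frame M)) = (\<subseteq>)"
    by (simp add: wallman_frame_def ideal_frame_def)
  show "partial_order (open_frame (wallman_extension M))"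
    by (rule partial_order_inclusion) (simp_all add: K)
  show "frame_lattice (wallman_frame (open_frame M))"
    by (rule O.frame_lattice_wallman_frame)
  show "U \<sqsubseteq>\<^bsub>open_frame (wallman_extension M)\<^esub> V \<longleftrightarrow>
      sigma_ideal U \<sqsubseteq>\<^bsub>wallman_frame (open_frame M)\<^esub> sigma_ideal V"
    if "U \<in> carrier (open_frame (wallman_extension M))" "V \<in> carrier (open_frame (wallman_extension M))"
    for U V
    using sigma_ideal_le_iff that by (simp add: K L)
  show "bij_betw sigma_ideal (carrier (open_frame (wallman_extension M)))
      (carrier (wallman_frame (open_frame M)))"
    unfolding bij_betw_def K
  proof
    show "inj_on sigma_ideal (wallman_opens M)"
      using sigma_ideal_le_iff by (intro inj_onI) (simp add: set_eq_subset)
    have "I \<in> sigma_ideal ` wallman_opens M" if I: "I \<in> carrier (wallman_frame (open_frame M))" for I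
    proof -
      have "I \<subseteq> mt_opens M"
        using I O.suited_ideals O.lattice_idealsD(1)[of I] by (auto simp: wallman_frame_def open_frame_simps)
      then have "open_join_sigma I \<in> wallman_opens M" by (auto simp: wallman_opens_eq)
      then show ?thesis using sigma_ideal_surj[OF I] by (metis image_eqI)
    qed
    then show "sigma_ideal ` wallman_opens M = carrier (wallman_frame (open_frame M))"
      using sigma_ideal_suited[OF wallman_opens_regular] by auto
  qed
qed

end

theorem theorem4p13:
  fixes M :: "'a mt_struct"
  assumes "mt_algebra M"
    and "mt_T1 M"
  shows "\<exists>\<alpha>. frame_iso (open_frame (wallman_extension M)) (wallman_frame (open_frame M)) \<alpha> \<and>
    (\<forall>U \<in> mt_opens (wallman_extension M).
       wallman_nu (open_frame M) (\<alpha> U) = wallman_rho M U)"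
proof -
  interpret mt_algebra M by fact
  \<comment> \<open>\<open>wallman_nu\<close> joins, in the frame of opens, the very set of opens
    that \<open>wallman_rho\<close> joins.\<close>
  have "wallman_nu (open_frame M) (sigma_ideal U) = wallman_rho M U" for U
    by (simp add: wallman_nu_def wallman_rho_def sigma_ideal_def)
  then show ?thesis using sigma_ideal_iso by blast
qed

end
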